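(* Let $T>0$, $\omega=2\pi/T$, let $p$ be a real-valued $T$-periodic function with Fourier coefficients $\widetilde p_\ell$ satisfying $\sum_{\ell}|\widetilde p_\ell|(1+\ell^2)^{1/4}<\infty$, and let $\lambda\in\mathbb C\setminus\{0\}$. Then: (i) The limit $\Delta(s;\lambda):=\lim_{N\to\infty}\Delta^{(N)}(s;\lambda)$ exists for all $s\in\mathbb C\setminus\Lambda$, uniformly in $s$ with $\operatorname{dist}(s,\Lambda)>\delta$ for each $\delta>0$; and if $|\operatorname{Im}s|<1$, the limit coincides with $\det(I-\lambda^{-1}H(s))$. (ii) The function $s\mapsto\Delta(s;\lambda)$ is even, doubly periodic with periods $2i$ and $\omega$, and satisfies $\overline{\Delta(s;\lambda)}=\Delta(\bar s;\bar\lambda)$ and $\Delta(s+i;\lambda)=\Delta(s;-\lambda)$. Furthermore, $\Delta(\cdot;\lambda)$ is either constant on $\mathbb C$, or an elliptic function of order two with simple poles at the points of $\Lambda$, and $\operatorname{Res}_{s=i/2}\Delta(s;\lambda)=-\operatorname{Res}_{s=-i/2}\Delta(s;\lambda)$. (iii) If $\Delta(\cdot;\lambda)$ is non-constant, then the zeros of $\partial\Delta(s;\lambda)/\partial s$ are simple and the set of these zeros consists exactly of the points congruent to $0,\ \omega/2,\ \omega/2+i,\ i$ modulo the lattice $\mathsf M=\{\omega m+2in:m,n\in\mathbb Z\}$.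
   Context: $\widetilde p_\ell=\frac1T\int_0^Te^{-i\ell\omega x}p(x)dx$, $B(z_1,z_2)=\Gamma(z_1)\Gamma(z_2)/\Gamma(z_1+z_2)$, $\Lambda=\{\omega n+i(m+\frac12):n,m\in\mathbb Z\}$. For $s\in\mathbb C\setminus\Lambda$, $H(s)$ is the operator on $\ell^2(\mathbb Z)$ with matrix $[H(s)]_{n,m}=B(\frac12-i\omega n-is,\frac12+i\omega m+is)\widetilde p_{n-m}$; it is trace class for $|\operatorname{Im}s|<1$, $s\notin\Lambda$. For $N\ge1$, $H^{(N)}(s)$ is the operator with matrix entries equal to those of $H(s)$ when $|n-m|\le N$ and $0$ otherwise (the operator associated with the truncated trigonometric polynomial $\sum_{|\ell|\le N}\widetilde p_\ell e^{i\ell\omega\xi}$); it is trace class and holomorphic for all $s\in\mathbb C\setminus\Lambda$, and $\Delta^{(N)}(s;\lambda)=\det(I-\lambda^{-1}H^{(N)}(s))$ is the Fredholm determinant. *)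

theory Defs
  imports "HOL-Complex_Analysis.Complex_Analysis"
begin

definition om :: "real \<Rightarrow> real" where
  "om T = 2 * pi / T"

definition ptilde :: "(real \<Rightarrow> real) \<Rightarrow> real \<Rightarrow> int \<Rightarrow> complex" where
  "ptilde p T l = complex_of_real (1 / T) *
      integral {0..T} (\<lambda>x. exp (- \<i> * of_int l * of_real (om T) * of_real x) * of_real (p x))"

definition Lam :: "real \<Rightarrow> complex set" where
  "Lam T = {of_real (om T) * of_int n + \<i> * (of_int m + 1/2) | n m :: int. True}"

definition Mlat :: "real \<Rightarrow> complex set" where
  "Mlat T = {of_real (om T) * of_int m + 2 * \<i> * of_int n | m n :: int. True}"

definition Hmat :: "(real \<Rightarrow> real) \<Rightarrow> real \<Rightarrow> complex \<Rightarrow> int \<Rightarrow> int \<Rightarrow> complex" where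
  "Hmat p T s n m = Beta (1/2 - \<i> * of_real (om T) * of_int n - \<i> * s)
                         (1/2 + \<i> * of_real (om T) * of_int m + \<i> * s) * ptilde p T (n - m)"

definition HNmat :: "(real \<Rightarrow> real) \<Rightarrow> real \<Rightarrow> nat \<Rightarrow> complex \<Rightarrow> int \<Rightarrow> int \<Rightarrow> complex" where
  "HNmat p T N s n m = (if \<bar>n - m\<bar> \<le> int N then Hmat p T s n m else 0)"

definition pminor :: "(int \<Rightarrow> int \<Rightarrow> complex) \<Rightarrow> int set \<Rightarrow> complex" where
  "pminor K S = (\<Sum>\<pi> | \<pi> permutes S. of_int (sign \<pi>) * (\<Prod>i\<in>S. K i (\<pi> i)))"

text \<open>Fredholm determinant det(I - K) of a trace class operator K on l^2(Z), given by
  its matrix, via the (absolutely convergent) Fredholm expansion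
  det(I - K) = sum over finite S subset Z of (-1)^|S| det(K restricted to S).\<close>
definition fredholm_det_I_minus :: "(int \<Rightarrow> int \<Rightarrow> complex) \<Rightarrow> complex" where
  "fredholm_det_I_minus K = (\<Sum>\<^sub>\<infinity>S\<in>{S. finite S}. (-1) ^ card S * pminor K S)"

definition DeltaN :: "(real \<Rightarrow> real) \<Rightarrow> real \<Rightarrow> nat \<Rightarrow> complex \<Rightarrow> complex \<Rightarrow> complex" where
  "DeltaN p T N lam s = fredholm_det_I_minus (\<lambda>n m. HNmat p T N s n m / lam)"

definition Delta :: "(real \<Rightarrow> real) \<Rightarrow> real \<Rightarrow> complex \<Rightarrow> complex \<Rightarrow> complex" where
  "Delta p T lam s = lim (\<lambda>N. DeltaN p T N lam s)"

end

theory Submission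
  imports Defs
begin

text \<open>
  Principal minors are unchanged by conjugation with a diagonal matrix. Conjugating \<open>H(s)\<close> by the
  diagonal matrix with entries \<open>Gamma (1/2 + \<i> \<omega> m + \<i> s)\<close> and using the reflection formula turns
  it into \<open>pi / cosh (pi (s + \<omega> n)) * q (n - m)\<close> with \<open>q l = ptilde l / Gamma (1 - \<i> \<omega> l)\<close>,
  so that \<open>s\<close> enters only through the row factors; all symmetries of the determinant can be
  read off from this form. A second conjugation with weights \<open>exp (pi \<omega> \<bar>n\<bar> / 2)\<close> makes the row sums
  summable, because \<open>\<bar>q l\<bar>\<close> is of order \<open>\<bar>ptilde l\<bar> exp (pi \<omega> \<bar>l\<bar> / 2) / sqrt \<bar>l\<bar>\<close> and about \<open>\<bar>l\<bar>\<close> pairs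
  \<open>(n, m)\<close> with \<open>n - m = l\<close> contribute. Bounding a minor by the product of its row sums dominates the
  Fredholm expansion uniformly in the truncation, away from \<open>\<Lambda>\<close>, and with at most simple poles there.

  For the elliptic part, \<open>\<Delta>(s) + \<Delta>(s + \<i>)\<close> has no poles, hence is a constant \<open>2 c\<close>, and \<open>f = \<Delta> - c\<close> is
  even and antiperiodic under \<open>\<i>\<close>. If \<open>r\<close> is its residue at \<open>\<i> / 2\<close>, Liouville's theorem gives
  \<open>f'' = 2 f^3 / r^2 + b f\<close>, so \<open>f'^2\<close> is a quadratic polynomial in \<open>f^2\<close>. At a critical point \<open>f^2\<close> is one
  of its two roots, hence \<open>f\<close> agrees there to first order with \<open>f\<close> at one of the four half periods;
  by uniqueness for the differential equation the two points differ by a period.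
\<close>

section \<open>Principal minors and Fredholm expansions\<close>

text \<open>Expanding the product of the row sums gives a sum over all maps from \<open>S\<close> to
  \<open>S\<close>. The permutations are some of these maps, each determined by its restriction to
  \<open>S\<close>, and the remaining terms are nonnegative.\<close>

lemma sum_permutes_prod_le:
  fixes a :: "'a \<Rightarrow> 'a \<Rightarrow> real"
  assumes S: "finite S" and a: "\<And>i j. a i j \<ge> 0"
  shows "(\<Sum>\<pi> | \<pi> permutes S. \<Prod>i\<in>S. a i (\<pi> i)) \<le> (\<Prod>i\<in>S. \<Sum>j\<in>S. a i j)"
proof -
  have "(\<Sum>\<pi> | \<pi> permutes S. \<Prod>i\<in>S. a i (\<pi> i))
      = (\<Sum>\<pi> | \<pi> permutes S. \<Prod>i\<in>S. a i (restrict \<pi> S i))"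
    by (intro sum.cong prod.cong) auto
  also have "\<dots> = (\<Sum>h\<in>(\<lambda>\<pi>. restrict \<pi> S) ` {\<pi>. \<pi> permutes S}. \<Prod>i\<in>S. a i (h i))"
  proof (subst sum.reindex)
    show "inj_on (\<lambda>\<pi>. restrict \<pi> S) {\<pi>. \<pi> permutes S}"
    proof (rule inj_onI, rule ext)
      fix \<pi> \<sigma> x assume "\<pi> \<in> {\<pi>. \<pi> permutes S}" "\<sigma> \<in> {\<pi>. \<pi> permutes S}" "restrict \<pi> S = restrict \<sigma> S"
      thus "\<pi> x = \<sigma> x" by (cases "x \<in> S") (auto simp: permutes_not_in dest: fun_cong[of _ _ x])
    qed
  qed (simp add: o_def)
  also have "\<dots> \<le> (\<Sum>h\<in>S \<rightarrow>\<^sub>E S. \<Prod>i\<in>S. a i (h i))"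
    using S a by (intro sum_mono2 finite_PiE) (auto intro!: prod_nonneg simp: permutes_in_image)
  also have "\<dots> = (\<Prod>i\<in>S. \<Sum>j\<in>S. a i j)"
    using S by (subst prod_sum_PiE) auto
  finally show ?thesis .
qed

text \<open>A crude substitute for Hadamard's inequality. With row sums, a bound on each row turns
  into a bound on the whole Fredholm series.\<close>

lemma norm_pminor_le:
  assumes "finite S"
  shows "norm (pminor K S) \<le> (\<Prod>i\<in>S. \<Sum>j\<in>S. norm (K i j))"
proof -
  have "norm (pminor K S) \<le> (\<Sum>\<pi> | \<pi> permutes S. \<Prod>i\<in>S. norm (K i (\<pi> i)))"
    unfolding pminor_def
    by (rule order.trans[OF norm_sum]) (auto simp: norm_mult prod_norm sign_def intro!: sum_mono)
  also have "\<dots> \<le> (\<Prod>i\<in>S. \<Sum>j\<in>S. norm (K i j))"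
    using assms by (rule sum_permutes_prod_le) auto
  finally show ?thesis .
qed

lemma pminor_cong:
  "(\<And>i j. i \<in> S \<Longrightarrow> j \<in> S \<Longrightarrow> K i j = L i j) \<Longrightarrow> pminor K S = pminor L S"
  unfolding pminor_def by (rule sum.cong, simp, rule arg_cong, rule prod.cong) (auto simp: permutes_in_image)

text \<open>Along a permutation the row factors \<open>d i\<close> and the column factors
  \<open>d (\<pi> i)\<close> run through the same values, so their products cancel.\<close>

lemma pminor_diagonal_conjugation:
  assumes d: "\<And>n. d n \<noteq> 0"
  shows "pminor (\<lambda>n m. d n * K n m / d m) S = pminor K S"
  unfolding pminor_def
proof (rule sum.cong)
  fix \<pi> assume "\<pi> \<in> {\<pi>. \<pi> permutes S}"
  hence p: "\<pi> permutes S" by simp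
  have dp: "(\<Prod>i\<in>S. d (\<pi> i)) = (\<Prod>i\<in>S. d i)"
    using prod.permute[OF p, of d] by (simp add: o_def)
  have "(\<Prod>i\<in>S. d i * K i (\<pi> i) / d (\<pi> i)) = (\<Prod>i\<in>S. d i) * (\<Prod>i\<in>S. K i (\<pi> i)) / (\<Prod>i\<in>S. d (\<pi> i))"
    by (simp add: prod.distrib prod_dividef)
  also have "\<dots> = (\<Prod>i\<in>S. K i (\<pi> i))"
    \<comment> \<open>For infinite \<open>S\<close> every product has the default value 1, so the
      quotient is harmless there too.\<close>
    unfolding dp using d by (cases "finite S") (auto simp: prod_zero_iff)
  finally show "of_int (sign \<pi>) * (\<Prod>i\<in>S. d i * K i (\<pi> i) / d (\<pi> i)) = of_int (sign \<pi>) * (\<Prod>i\<in>S. K i (\<pi> i))"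
    by simp
qed simp

text \<open>Summing over the inverse permutations, which have the same signs, exchanges rows and
  columns.\<close>

lemma pminor_transpose:
  assumes S: "finite S"
  shows "pminor (\<lambda>n m. K m n) S = pminor K S"
  unfolding pminor_def
proof (rule sum.reindex_bij_witness[of _ inv inv])
  fix \<pi> assume "\<pi> \<in> {\<pi>. \<pi> permutes S}"
  hence p: "\<pi> permutes S" by simp
  show "inv (inv \<pi>) = \<pi>" using p by (simp add: permutes_inv_inv)
  show "inv \<pi> \<in> {\<pi>. \<pi> permutes S}" using p by (simp add: permutes_inv)
  have "(\<Prod>i\<in>S. K i (inv \<pi> i)) = (\<Prod>i\<in>S. K (\<pi> i) (inv \<pi> (\<pi> i)))"
    using prod.permute[OF p, of "\<lambda>i. K i (inv \<pi> i)"] by (simp add: o_def)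
  also have "\<dots> = (\<Prod>i\<in>S. K (\<pi> i) i)"
    using p by (simp add: permutes_inverses)
  moreover have "permutation \<pi>" using p S permutation_permutes by blast
  ultimately show "of_int (sign (inv \<pi>)) * (\<Prod>i\<in>S. K i (inv \<pi> i)) = of_int (sign \<pi>) * (\<Prod>i\<in>S. K (\<pi> i) i)"
    by (simp add: sign_inverse)
next
  fix \<pi> assume "\<pi> \<in> {\<pi>. \<pi> permutes S}"
  hence p: "\<pi> permutes S" by simp
  show "inv (inv \<pi>) = \<pi>" using p by (simp add: permutes_inv_inv)
  show "inv \<pi> \<in> {\<pi>. \<pi> permutes S}" using p by (simp add: permutes_inv)
qed

text \<open>Permutations of \<open>S\<close> and of its image correspond through transport along
  \<open>\<sigma>\<close>, which preserves signs.\<close>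

lemma pminor_reindex:
  assumes \<sigma>: "bij \<sigma>" and S: "finite S"
  shows "pminor (\<lambda>n m. K (\<sigma> n) (\<sigma> m)) S = pminor K (\<sigma> ` S)"
  unfolding pminor_def
proof (rule sum.reindex_bij_witness[of _ "map_permutation (\<sigma> ` S) (inv \<sigma>)" "map_permutation S \<sigma>"])
  have inj: "inj \<sigma>" using \<sigma> by (rule bij_is_inj)
  have isig: "inj (inv \<sigma>)" using bij_imp_bij_inv[OF \<sigma>] by (rule bij_is_inj)
  have i: "inj_on \<sigma> S" using inj by (rule inj_on_subset) simp
  hence b1: "bij_betw \<sigma> S (\<sigma> ` S)" by (rule inj_on_imp_bij_betw)
  have b2: "bij_betw (inv \<sigma>) (\<sigma> ` S) S"
    unfolding bij_betw_def using inj inj_on_subset[OF isig, of "\<sigma> ` S"] by (simp add: image_inv_f_f)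
  {
    fix \<pi> assume "\<pi> \<in> {\<pi>. \<pi> permutes S}"
    hence p: "\<pi> permutes S" by simp
    show "map_permutation (\<sigma> ` S) (inv \<sigma>) (map_permutation S \<sigma> \<pi>) = \<pi>"
      using map_permutation_compose_inv[OF b1 p] inj by simp
    show "map_permutation S \<sigma> \<pi> \<in> {\<pi>. \<pi> permutes \<sigma> ` S}"
      using map_permutation_permutes[OF b1 p] by simp
    have "(\<Prod>j\<in>\<sigma> ` S. K j (map_permutation S \<sigma> \<pi> j)) = (\<Prod>j\<in>S. K (\<sigma> j) (\<sigma> (\<pi> j)))"
      using i by (simp add: prod.reindex map_permutation_apply)
    thus "of_int (sign (map_permutation S \<sigma> \<pi>)) * (\<Prod>j\<in>\<sigma> ` S. K j (map_permutation S \<sigma> \<pi> j))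
        = of_int (sign \<pi>) * (\<Prod>j\<in>S. K (\<sigma> j) (\<sigma> (\<pi> j)))"
      using sign_map_permutation[OF i p S] by simp
  }
  {
    fix \<pi> assume "\<pi> \<in> {\<pi>. \<pi> permutes \<sigma> ` S}"
    hence p: "\<pi> permutes \<sigma> ` S" by simp
    show "map_permutation S \<sigma> (map_permutation (\<sigma> ` S) (inv \<sigma>) \<pi>) = \<pi>"
      using map_permutation_compose_inv[OF b2 p] \<sigma> by (simp add: bij_is_surj surj_f_inv_f)
    show "map_permutation (\<sigma> ` S) (inv \<sigma>) \<pi> \<in> {\<pi>. \<pi> permutes S}"
      using map_permutation_permutes[OF b2 p] by simp
  }
qed

lemma fredholm_det_cong:
  assumes "\<And>S. finite S \<Longrightarrow> pminor K S = pminor L S"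
  shows "fredholm_det_I_minus K = fredholm_det_I_minus L"
  unfolding fredholm_det_I_minus_def by (rule infsum_cong) (simp add: assms)

text \<open>Applied below to the shift and to the reflection of the integers, which produce the
  period \<open>om T\<close> and the evenness of the determinant.\<close>

lemma fredholm_det_reindex:
  assumes \<sigma>: "bij \<sigma>"
  shows "fredholm_det_I_minus (\<lambda>n m. K (\<sigma> n) (\<sigma> m)) = fredholm_det_I_minus K"
proof -
  have inj: "inj \<sigma>" using \<sigma> by (rule bij_is_inj)
  have b: "bij_betw (image \<sigma>) {S. finite S} {S. finite S}"
  proof (rule bij_betw_byWitness[of _ "image (inv \<sigma>)"])
    show "\<forall>S\<in>{S. finite S}. inv \<sigma> ` \<sigma> ` S = S" using inj by (auto simp: image_comp)
    show "\<forall>S\<in>{S. finite S}. \<sigma> ` inv \<sigma> ` S = S"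
      using \<sigma> by (auto simp: image_comp bij_is_surj surj_f_inv_f o_def)
  qed auto
  have "card (\<sigma> ` S) = card S" for S using inj by (simp add: card_image inj_on_def)
  hence "fredholm_det_I_minus (\<lambda>n m. K (\<sigma> n) (\<sigma> m))
      = (\<Sum>\<^sub>\<infinity>S\<in>{S. finite S}. (-1) ^ card (\<sigma> ` S) * pminor K (\<sigma> ` S))"
    unfolding fredholm_det_I_minus_def by (intro infsum_cong) (simp add: pminor_reindex[OF \<sigma>])
  also have "\<dots> = fredholm_det_I_minus K"
    unfolding fredholm_det_I_minus_def by (rule infsum_reindex_bij_betw[OF b])
  finally show ?thesis .
qed

lemma cnj_fredholm_det: "cnj (fredholm_det_I_minus K) = fredholm_det_I_minus (\<lambda>n m. cnj (K n m))"
proof -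
  have "cnj (pminor K S) = pminor (\<lambda>n m. cnj (K n m)) S" for S by (simp add: pminor_def)
  thus ?thesis unfolding fredholm_det_I_minus_def
    by (subst infsum_cnj[symmetric]) (simp del: infsum_cnj)
qed

text \<open>A finite family of sets lies in the power set of its union \<open>U\<close>. Over that
  power set the sum factors into the product of the terms \<open>1 + R n\<close>, which is at most
  the exponential of the total sum.\<close>

lemma summable_on_prod_finite_sets:
  fixes R :: "'a \<Rightarrow> real"
  assumes R: "R summable_on UNIV" "\<And>n. R n \<ge> 0"
  shows "(\<lambda>S. \<Prod>n\<in>S. R n) summable_on {S. finite S}"
proof (rule nonneg_bounded_partial_sums_imp_summable_on)
  show "\<forall>\<^sub>F \<F> in finite_subsets_at_top {S. finite S}. (\<Sum>S\<in>\<F>. \<Prod>n\<in>S. R n) \<le> exp (infsum R UNIV)"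
  proof (rule eventually_finite_subsets_at_top_weakI)
    fix \<F> :: "'a set set" assume F: "finite \<F>" "\<F> \<subseteq> {S. finite S}"
    define U where "U = \<Union>\<F>"
    have U: "finite U" using F by (auto simp: U_def)
    have "(\<Sum>S\<in>\<F>. \<Prod>n\<in>S. R n) \<le> (\<Sum>S\<in>Pow U. \<Prod>n\<in>S. R n)"
      using U R(2) by (intro sum_mono2) (auto simp: U_def intro!: prod_nonneg)
    also have "\<dots> = (\<Prod>n\<in>U. R n + 1)" using prod_add[OF U, of R "\<lambda>_. 1"] by simp
    also have "\<dots> \<le> (\<Prod>n\<in>U. exp (R n))"
      using R(2) by (intro prod_mono) (auto simp: add.commute intro: add_nonneg_nonneg)
    also have "\<dots> = exp (\<Sum>n\<in>U. R n)" using U by (simp add: exp_sum)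
    also have "(\<Sum>n\<in>U. R n) \<le> infsum R UNIV"
      using R U by (intro finite_sum_le_infsum) auto
    finally show "(\<Sum>S\<in>\<F>. \<Prod>n\<in>S. R n) \<le> exp (infsum R UNIV)" by simp
  qed
qed (use R in \<open>auto intro!: prod_nonneg\<close>)

section \<open>Exponentially weighted sums over the integers and over Toeplitz arrays\<close>

lemma summable_on_exp_abs_int:
  fixes c :: real
  assumes c: "c > 0"
  shows "(\<lambda>m::int. exp (- c * \<bar>real_of_int m\<bar>)) summable_on UNIV"
proof -
  have nat: "(\<lambda>n::nat. exp (- c * real n)) summable_on UNIV"
  proof (rule norm_summable_imp_summable_on)
    have "(\<lambda>n::nat. exp (- c * real n)) = (\<lambda>n. exp (- c) ^ n)"
      by (simp add: fun_eq_iff exp_of_nat_mult[symmetric] mult.commute)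
    thus "summable (\<lambda>n::nat. norm (exp (- c * real n)))"
      using c by (simp add: summable_geometric)
  qed
  have "(\<lambda>m::int. exp (- c * \<bar>real_of_int m\<bar>)) summable_on range int"
    using nat by (subst summable_on_reindex) (auto simp: o_def)
  moreover have "(\<lambda>m::int. exp (- c * \<bar>real_of_int m\<bar>)) summable_on range (\<lambda>n. - int n)"
    using nat by (subst summable_on_reindex) (auto simp: o_def inj_on_def)
  ultimately have "(\<lambda>m::int. exp (- c * \<bar>real_of_int m\<bar>)) summable_on (range int \<union> range (\<lambda>n. - int n))"
    by (rule summable_on_union)
  moreover have "range int \<union> range (\<lambda>n. - int n) = UNIV"
    by (auto simp: image_def) (metis int_cases2)
  ultimately show ?thesis by simp
qed

text \<open>For \<open>m\<close> between \<open>0\<close> and \<open>- l\<close> the exponent \<open>\<bar>l + m\<bar> + \<bar>m\<bar>\<close> equals \<open>\<bar>l\<bar>\<close>;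
  outside this interval it grows by twice the distance to the interval.\<close>
lemma exp_convolution_bound:
  fixes a :: real
  assumes a: "a > 0"
  obtains C where "C \<ge> 0" "\<And>l::int. (\<lambda>m::int. exp (- a * \<bar>real_of_int (l + m)\<bar>) * exp (- a * \<bar>real_of_int m\<bar>)) summable_on UNIV"
    "\<And>l::int. (\<Sum>\<^sub>\<infinity>m::int. exp (- a * \<bar>real_of_int (l + m)\<bar>) * exp (- a * \<bar>real_of_int m\<bar>))
      \<le> C * (1 + \<bar>real_of_int l\<bar>) * exp (- a * \<bar>real_of_int l\<bar>)"
proof -
  define E where "E = (\<lambda>m::int. exp (- (2 * a) * \<bar>real_of_int m\<bar>))"
  have E: "E summable_on UNIV" unfolding E_def using a by (intro summable_on_exp_abs_int) auto
  define G where "G = infsum E UNIV"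
  have G: "G \<ge> 0" unfolding G_def by (intro infsum_nonneg) (auto simp: E_def)
  define F where "F = (\<lambda>l m::int. exp (- a * \<bar>real_of_int (l + m)\<bar>) * exp (- a * \<bar>real_of_int m\<bar>))"
  define I where "I = (\<lambda>l::int. {min 0 (- l)..max 0 (- l)})"
  \<comment> \<open>A majorant with an explicit sum: the indicator of the interval contributes its
    \<open>1 + \<bar>l\<bar>\<close> integers, and the two terms \<open>E\<close> handle the decay
    away from \<open>0\<close> and away from \<open>- l\<close>.\<close>
  define H where "H = (\<lambda>l m::int. exp (- a * \<bar>real_of_int l\<bar>) * (of_bool (m \<in> I l) + (E m + E (l + m))))"
  have FH: "F l m \<le> H l m" for l m
  proof -
    have *: "exp (- a * \<bar>real_of_int l\<bar>) * E k = exp (- a * (\<bar>real_of_int l\<bar> + 2 * \<bar>real_of_int k\<bar>))" for k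
      by (simp add: E_def exp_add[symmetric] algebra_simps)
    have F: "F l m = exp (- a * (\<bar>real_of_int (l + m)\<bar> + \<bar>real_of_int m\<bar>))"
      by (simp add: F_def exp_add[symmetric] algebra_simps)
    have Epos: "E k \<ge> 0" for k by (simp add: E_def)
    consider "m \<in> I l" | "\<bar>l + m\<bar> + \<bar>m\<bar> = \<bar>l\<bar> + 2 * \<bar>m\<bar>" | "\<bar>l + m\<bar> + \<bar>m\<bar> = \<bar>l\<bar> + 2 * \<bar>l + m\<bar>"
      unfolding I_def atLeastAtMost_iff by (cases "l \<ge> 0"; cases "m \<ge> 0"; cases "l + m \<ge> 0") auto
    thus ?thesis
    proof cases
      case 1
      have "F l m \<le> exp (- a * \<bar>real_of_int l\<bar>)" unfolding F using a by simp
      also have "\<dots> * 1 \<le> H l m" unfolding H_def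
        using 1 Epos[of m] Epos[of "l + m"] by (intro mult_left_mono) auto
      finally show ?thesis by simp
    next
      case 2
      have "\<bar>real_of_int (l + m)\<bar> + \<bar>real_of_int m\<bar> = \<bar>real_of_int l\<bar> + 2 * \<bar>real_of_int m\<bar>"
        using arg_cong[OF 2, of real_of_int] by simp
      hence "F l m = exp (- a * \<bar>real_of_int l\<bar>) * E m" unfolding F * by simp
      also have "\<dots> \<le> H l m" unfolding H_def
        using Epos[of "l + m"] by (intro mult_left_mono) auto
      finally show ?thesis .
    next
      case 3
      have "\<bar>real_of_int (l + m)\<bar> + \<bar>real_of_int m\<bar> = \<bar>real_of_int l\<bar> + 2 * \<bar>real_of_int (l + m)\<bar>"
        using arg_cong[OF 3, of real_of_int] by simp
      hence "F l m = exp (- a * \<bar>real_of_int l\<bar>) * E (l + m)" unfolding F * by simp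
      also have "\<dots> \<le> H l m" unfolding H_def
        using Epos[of m] by (intro mult_left_mono) auto
      finally show ?thesis .
    qed
  qed
  have bij: "bij_betw (\<lambda>m. l + m) (UNIV :: int set) UNIV" for l
    by (rule bij_betw_byWitness[of _ "\<lambda>m. m - l"]) auto
  have hsI: "((\<lambda>m. of_bool (m \<in> I l)) has_sum (1 + \<bar>real_of_int l\<bar>)) UNIV" for l
  proof -
    have "((\<lambda>m. of_bool (m \<in> I l) :: real) has_sum (\<Sum>m\<in>I l. of_bool (m \<in> I l))) (I l)"
      by (rule has_sum_finite) (simp add: I_def)
    moreover have "(\<Sum>m\<in>I l. of_bool (m \<in> I l) :: real) = 1 + \<bar>real_of_int l\<bar>"
      by (simp add: I_def)
    moreover have "((\<lambda>m. of_bool (m \<in> I l) :: real) has_sum x) UNIV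
        \<longleftrightarrow> ((\<lambda>m. of_bool (m \<in> I l)) has_sum x) (I l)" for x
      by (rule has_sum_cong_neutral) auto
    ultimately show ?thesis by simp
  qed
  have hsE: "((\<lambda>m. E (l + m)) has_sum G) UNIV" for l
    using E unfolding G_def by (subst has_sum_reindex_bij_betw[OF bij]) simp
  have hsH: "(H l has_sum (exp (- a * \<bar>real_of_int l\<bar>) * ((1 + \<bar>real_of_int l\<bar>) + (G + G)))) UNIV" for l
    unfolding H_def
    by (intro has_sum_cmult_right has_sum_add hsI hsE) (use hsE[of 0] in simp)
  have sF: "F l summable_on UNIV" for l
    by (rule summable_on_comparison_test[of "H l"]) (use hsH FH in \<open>auto simp: summable_on_def F_def\<close>)
  have iF: "infsum (F l) UNIV \<le> (1 + 2 * G) * (1 + \<bar>real_of_int l\<bar>) * exp (- a * \<bar>real_of_int l\<bar>)" for l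
  proof -
    have "infsum (F l) UNIV \<le> infsum (H l) UNIV"
      using sF hsH FH by (intro infsum_mono) (auto simp: summable_on_def)
    also have "\<dots> = exp (- a * \<bar>real_of_int l\<bar>) * ((1 + \<bar>real_of_int l\<bar>) + (G + G))"
      using hsH by (rule infsumI)
    also have "(1 + \<bar>real_of_int l\<bar>) + (G + G) \<le> (1 + 2 * G) * (1 + \<bar>real_of_int l\<bar>)"
      using G by (simp add: algebra_simps)
    finally show ?thesis by (simp add: mult_left_mono mult.commute)
  qed
  show thesis
    by (rule that[of "1 + 2 * G"]) (use G sF iF in \<open>auto simp: F_def\<close>)
qed

text \<open>In the coordinates \<open>l = n - m\<close> and \<open>m\<close> the inner sum is the
  convolution bounded by \<open>exp_convolution_bound\<close>; its linear factor reappears in the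
  assumption on \<open>g\<close>.\<close>

lemma summable_on_weighted_toeplitz:
  fixes a :: real and g :: "int \<Rightarrow> real"
  assumes a: "a > 0" and g: "\<And>l. g l \<ge> 0"
    and sum: "(\<lambda>l. g l * ((1 + \<bar>real_of_int l\<bar>) * exp (- a * \<bar>real_of_int l\<bar>))) summable_on UNIV"
  shows "(\<lambda>(n, m). g (n - m) * (exp (- a * \<bar>real_of_int n\<bar>) * exp (- a * \<bar>real_of_int m\<bar>))) summable_on UNIV \<times> UNIV"
proof -
  obtain C where C: "C \<ge> 0"
    "\<And>l::int. (\<lambda>m::int. exp (- a * \<bar>real_of_int (l + m)\<bar>) * exp (- a * \<bar>real_of_int m\<bar>)) summable_on UNIV"
    "\<And>l::int. (\<Sum>\<^sub>\<infinity>m::int. exp (- a * \<bar>real_of_int (l + m)\<bar>) * exp (- a * \<bar>real_of_int m\<bar>))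
      \<le> C * (1 + \<bar>real_of_int l\<bar>) * exp (- a * \<bar>real_of_int l\<bar>)"
    by (rule exp_convolution_bound[OF a]) blast
  define F where "F = (\<lambda>l m::int. exp (- a * \<bar>real_of_int (l + m)\<bar>) * exp (- a * \<bar>real_of_int m\<bar>))"
  have Fpos: "F l m \<ge> 0" for l m by (simp add: F_def)
  have "(\<lambda>(l, m). g l * F l m) summable_on UNIV \<times> UNIV"
  proof (rule summable_on_SigmaI[where g = "\<lambda>l. g l * infsum (F l) UNIV"])
    show "((\<lambda>m. case (l, m) of (l, m) \<Rightarrow> g l * F l m) has_sum g l * infsum (F l) UNIV) UNIV" for l
      using C(2)[of l] by (auto intro!: has_sum_cmult_right simp: F_def)
    show "(\<lambda>l. g l * infsum (F l) UNIV) summable_on UNIV"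
    proof (rule summable_on_comparison_test)
      show "(\<lambda>l. C * (g l * ((1 + \<bar>real_of_int l\<bar>) * exp (- a * \<bar>real_of_int l\<bar>)))) summable_on UNIV"
        by (intro summable_on_cmult_right sum)
      show "g l * infsum (F l) UNIV \<le> C * (g l * ((1 + \<bar>real_of_int l\<bar>) * exp (- a * \<bar>real_of_int l\<bar>)))" for l
        using mult_left_mono[OF C(3)[of l] g[of l]] by (simp add: F_def mult_ac)
      show "0 \<le> g l * infsum (F l) UNIV" for l
        using g Fpos by (intro mult_nonneg_nonneg infsum_nonneg) auto
    qed
  qed (use g Fpos in auto)
  moreover have "bij_betw (\<lambda>(n, m). (n - m, m)) (UNIV \<times> UNIV :: (int \<times> int) set) (UNIV \<times> UNIV)"
    by (rule bij_betw_byWitness[of _ "\<lambda>(l, m). (l + m, m)"]) auto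
  ultimately have "(\<lambda>x. case (case x of (n, m) \<Rightarrow> (n - m, m)) of (l, m) \<Rightarrow> g l * F l m) summable_on UNIV \<times> UNIV"
    by (subst summable_on_reindex_bij_betw)
  thus ?thesis by (simp add: F_def case_prod_unfold)
qed

section \<open>Elliptic functions with simple poles on the shifted lattice\<close>

lemma Lam_iff: "s \<in> Lam T \<longleftrightarrow> (\<exists>n m::int. s = of_real (om T) * of_int n + \<i> * (of_int m + 1/2))"
  by (auto simp: Lam_def)

lemma Lam_add: "s \<in> Lam T \<Longrightarrow> s + of_real (om T) * of_int n + \<i> * of_int m \<in> Lam T"
proof -
  assume "s \<in> Lam T"
  then obtain a b :: int where "s = of_real (om T) * of_int a + \<i> * (of_int b + 1/2)"
    by (auto simp: Lam_iff)
  hence "s + of_real (om T) * of_int n + \<i> * of_int m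
      = of_real (om T) * of_int (a + n) + \<i> * (of_int (b + m) + 1/2)"
    by (simp add: algebra_simps)
  thus ?thesis unfolding Lam_iff by blast
qed

lemma Lam_add_iff: "s + of_real (om T) * of_int n + \<i> * of_int m \<in> Lam T \<longleftrightarrow> s \<in> Lam T"
proof
  assume "s + of_real (om T) * of_int n + \<i> * of_int m \<in> Lam T"
  from Lam_add[OF this, of "-n" "-m"] show "s \<in> Lam T" by (simp add: algebra_simps)
qed (rule Lam_add)

lemma Lam_add_om [simp]: "s + of_real (om T) \<in> Lam T \<longleftrightarrow> s \<in> Lam T"
  using Lam_add_iff[of s T 1 0] by simp

lemma Lam_add_i [simp]: "s + \<i> \<in> Lam T \<longleftrightarrow> s \<in> Lam T"
  using Lam_add_iff[of s T 0 1] by simp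

lemma Lam_uminus [simp]: "- s \<in> Lam T \<longleftrightarrow> s \<in> Lam T"
proof -
  have *: "- s \<in> Lam T" if "s \<in> Lam T" for s
  proof -
    from that obtain a b :: int where "s = of_real (om T) * of_int a + \<i> * (of_int b + 1/2)"
      by (auto simp: Lam_iff)
    hence "- s = of_real (om T) * of_int (- a) + \<i> * (of_int (- b - 1) + 1/2)"
      by (simp add: algebra_simps)
    thus ?thesis unfolding Lam_iff by blast
  qed
  from *[of s] *[of "- s"] show ?thesis by auto
qed

lemma Lam_cnj [simp]: "cnj s \<in> Lam T \<longleftrightarrow> s \<in> Lam T"
proof -
  have *: "cnj s \<in> Lam T" if "s \<in> Lam T" for s
  proof -
    from that obtain a b :: int where "s = of_real (om T) * of_int a + \<i> * (of_int b + 1/2)"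
      by (auto simp: Lam_iff)
    hence "cnj s = of_real (om T) * of_int a + \<i> * (of_int (- b - 1) + 1/2)"
      by (simp add: algebra_simps)
    thus ?thesis unfolding Lam_iff by blast
  qed
  from *[of s] *[of "cnj s"] show ?thesis by auto
qed

lemma i_half_in_Lam: "\<i> / 2 \<in> Lam T"
  unfolding Lam_iff by (intro exI[of _ 0]) simp

lemma Lam_eq: "z \<in> Lam T \<Longrightarrow> \<exists>n m::int. z = \<i> / 2 + of_real (om T) * of_int n + \<i> * of_int m"
  by (force simp: Lam_iff algebra_simps)

lemma countable_Lam: "countable (Lam T)"
proof -
  have "Lam T = (\<lambda>(n, m). of_real (om T) * of_int n + \<i> * (of_int m + 1/2)) ` (UNIV :: (int \<times> int) set)"
    by (auto simp: Lam_def image_def)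
  thus ?thesis by simp
qed

text \<open>Real parts differ by integer multiples of \<open>om T\<close> and imaginary parts by
  integers, so two points closer than both units coincide.\<close>

lemma Lam_separated:
  assumes T: "T > 0" and x: "x \<in> Lam T" and y: "y \<in> Lam T" and d: "dist y x < min (om T) 1"
  shows "y = x"
proof -
  have w: "om T > 0" using T by (simp add: om_def)
  obtain a b :: int where xe: "x = of_real (om T) * of_int a + \<i> * (of_int b + 1/2)"
    using x by (auto simp: Lam_iff)
  obtain c e :: int where ye: "y = of_real (om T) * of_int c + \<i> * (of_int e + 1/2)"
    using y by (auto simp: Lam_iff)
  have "\<bar>Re (y - x)\<bar> < om T" "\<bar>Im (y - x)\<bar> < 1"
    using d abs_Re_le_cmod[of "y - x"] abs_Im_le_cmod[of "y - x"] by (auto simp: dist_norm)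
  moreover have "Re (y - x) = om T * real_of_int (c - a)" "Im (y - x) = real_of_int (e - b)"
    by (auto simp: xe ye algebra_simps)
  ultimately have "om T * \<bar>real_of_int (c - a)\<bar> < om T * 1" "\<bar>real_of_int (e - b)\<bar> < 1"
    using w by (auto simp: abs_mult)
  hence "\<bar>real_of_int (c - a)\<bar> < 1" "\<bar>real_of_int (e - b)\<bar> < 1"
    using w by (auto simp only: mult_less_cancel_left_pos)
  hence "c = a" "e = b" by linarith+
  thus ?thesis by (simp add: xe ye)
qed

lemma closed_Lam:
  assumes "T > 0" shows "closed (Lam T)"
  using assms Lam_separated[OF assms]
  by (intro discrete_imp_closed[of "min (om T) 1"]) (auto simp: om_def)

lemma open_compl_Lam: "T > 0 \<Longrightarrow> open (- Lam T)"
  using closed_Lam by auto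

lemma Lam_isolated:
  assumes "T > 0" "z \<in> Lam T" shows "ball z (min (om T) 1) - {z} \<subseteq> - Lam T"
  using Lam_separated[OF assms(1) assms(2)] by (auto simp: dist_commute)

lemma connected_compl_countable:
  fixes A :: "complex set" assumes "countable A" shows "connected (- A)"
  using path_connected_complement_countable[of A] assms path_connected_imp_connected by auto

lemma strip_reduction:
  assumes "T > 0"
  shows "\<exists>n::int. \<bar>Re (s + of_real (om T) * of_int n)\<bar> \<le> om T / 2"
proof -
  have w: "om T > 0" using assms by (simp add: om_def)
  define n where "n = round (Re s / om T)"
  have "\<bar>Re s / om T - of_int n\<bar> \<le> 1/2"
    unfolding n_def using of_int_round_abs_le[of "Re s / om T"] by (simp add: abs_minus_commute)
  hence "om T * \<bar>Re s / om T - of_int n\<bar> \<le> om T * (1/2)"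
    using w by (intro mult_left_mono) auto
  moreover have "om T * \<bar>Re s / om T - of_int n\<bar> = \<bar>om T * (Re s / om T - of_int n)\<bar>"
    using w by (simp add: abs_mult)
  moreover have "om T * (Re s / om T - of_int n) = Re (s + of_real (om T) * of_int (- n))"
    using w by (simp add: field_simps)
  ultimately show ?thesis by (intro exI[of _ "-n"]) simp
qed

text \<open>The values of \<open>g\<close> have an arbitrary type because the lemma is applied both
  to periodic functions and to the norm of functions that only change sign under
  \<open>\<i>\<close>.\<close>

lemma int_periodic:
  fixes g :: "complex \<Rightarrow> 'a" and d :: complex and n :: int
  assumes per: "\<And>s. s \<in> S \<Longrightarrow> g (s + d) = g s" and S: "\<And>s. s + d \<in> S \<longleftrightarrow> s \<in> S" and s: "s \<in> S"
  shows "g (s + d * of_int n) = g s"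
proof -
  have nat: "g (s + d * of_nat k) = g s \<and> s + d * of_nat k \<in> S" if "s \<in> S" for k s
  proof (induction k)
    case (Suc k)
    have "s + d * of_nat (Suc k) = (s + d * of_nat k) + d" by (simp add: algebra_simps)
    with Suc per[of "s + d * of_nat k"] S[of "s + d * of_nat k"] show ?case by metis
  qed (use that in simp)
  \<comment> \<open>Negative multiples are reached by stepping forward from \<open>s - k d\<close>,
    so that starting point has to lie in \<open>S\<close>.\<close>
  have mem: "s + d * of_int (- int k) \<in> S" for k
  proof (induction k)
    case (Suc k)
    have "s + d * of_int (- int k) = (s + d * of_int (- int (Suc k))) + d" by (simp add: algebra_simps)
    with Suc S show ?case by metis
  qed (use s in simp)
  show ?thesis
  proof (cases n rule: int_cases2)
    case (nonneg k) with nat[OF s, of k] show ?thesis by simp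
  next
    case (nonpos k) with nat[OF mem[of k], of k] show ?thesis by simp
  qed
qed

text \<open>Riemann's theorem extends \<open>(s - z) * f s\<close> to a holomorphic
  \<open>h\<close>. Then \<open>r = h z\<close>, and \<open>g\<close> is the difference quotient of
  \<open>h\<close> at \<open>z\<close>.\<close>

lemma simple_pole_split:
  fixes f :: "complex \<Rightarrow> complex"
  assumes e: "e > 0" and holo: "f holomorphic_on ball z e - {z}"
    and bd: "\<And>s. s \<in> ball z e - {z} \<Longrightarrow> norm ((s - z) * f s) \<le> B"
  obtains r g where "g holomorphic_on ball z e" "\<And>s. s \<in> ball z e - {z} \<Longrightarrow> f s = r / (s - z) + g s"
proof -
  have "\<exists>h. h holomorphic_on ball z e \<and> (\<forall>s\<in>ball z e - {z}. h s = (s - z) * f s)"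
  proof (subst holomorphic_on_extend_bounded)
    show "(\<lambda>s. (s - z) * f s) holomorphic_on ball z e - {z}"
      by (intro holomorphic_intros holo)
    show "\<exists>B. \<forall>\<^sub>F s in at z. norm ((s - z) * f s) \<le> B"
      unfolding eventually_at using bd e
      by (intro exI[of _ B] exI[of _ e]) (auto simp: dist_commute)
  qed (use e in auto)
  then obtain h where h: "h holomorphic_on ball z e" "\<And>s. s \<in> ball z e - {z} \<Longrightarrow> h s = (s - z) * f s"
    by blast
  show thesis
  proof
    show "(\<lambda>s. if s = z then deriv h z else (h s - h z) / (s - z)) holomorphic_on ball z e"
      by (rule pole_lemma_open[OF h(1)]) auto
    show "f s = h z / (s - z) + (if s = z then deriv h z else (h s - h z) / (s - z))"
      if "s \<in> ball z e - {z}" for s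
    proof -
      have "f s = h s / (s - z)" using h(2)[OF that] that by simp
      thus ?thesis using that by (simp add: diff_divide_distrib)
    qed
  qed
qed

text \<open>Only the norm of \<open>f\<close> has to be invariant under \<open>\<i>\<close>, so
  antiperiodic functions are covered. The function is bounded near \<open>\<i> / 2\<close> by
  assumption and on the rest of a period rectangle by compactness; hence all singularities are
  removable and the extension is a bounded entire function.\<close>

lemma elliptic_liouville:
  fixes f :: "complex \<Rightarrow> complex"
  assumes T: "T > 0" and holo: "f holomorphic_on - Lam T"
    and per: "\<And>s. s \<notin> Lam T \<Longrightarrow> f (s + of_real (om T)) = f s"
    and per_i: "\<And>s. s \<notin> Lam T \<Longrightarrow> norm (f (s + \<i>)) = norm (f s)"
    and e: "e > 0" and bd: "\<And>s. s \<in> ball (\<i> / 2) e - {\<i> / 2} \<Longrightarrow> norm (f s) \<le> B"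
  shows "\<exists>c. \<forall>s. s \<notin> Lam T \<longrightarrow> f s = c"
proof -
  have w: "om T > 0" using T by (simp add: om_def)
  \<comment> \<open>The rectangle contains a representative of every point modulo
    \<open>om T\<close> and \<open>\<i>\<close>, and \<open>\<i> / 2\<close> is its only point of
    \<open>Lam T\<close>.\<close>
  define K where "K = cbox (Complex (- om T / 2) 0) (Complex (om T / 2) 1) - ball (\<i> / 2) e"
  have K_Lam: "K \<subseteq> - Lam T"
  proof
    fix z assume z: "z \<in> K"
    show "z \<in> - Lam T"
    proof
      assume "z \<in> Lam T"
      then obtain a b :: int where ze: "z = of_real (om T) * of_int a + \<i> * (of_int b + 1/2)"
        by (auto simp: Lam_iff)
      have "\<bar>om T * real_of_int a\<bar> \<le> om T / 2" "0 \<le> real_of_int b + 1/2" "real_of_int b + 1/2 \<le> 1"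
        using z by (auto simp: K_def ze in_cbox_complex_iff)
      moreover from this have "om T * \<bar>real_of_int a\<bar> \<le> om T * (1/2)"
        using w by (simp add: abs_mult)
      hence "\<bar>real_of_int a\<bar> \<le> 1/2" using w by (simp only: mult_le_cancel_left_pos)
      ultimately have "a = 0" "b = 0" by linarith+
      hence "z = \<i> / 2" by (simp add: ze)
      moreover have "z \<notin> ball (\<i> / 2) e" using z by (simp add: K_def)
      ultimately show False using e by (metis centre_in_ball)
    qed
  qed
  have "compact K" unfolding K_def by (intro compact_diff) auto
  moreover have "continuous_on K f"
    using holomorphic_on_imp_continuous_on[OF holo] K_Lam continuous_on_subset by blast
  ultimately have "bounded (f ` K)" by (intro compact_imp_bounded compact_continuous_image)
  then obtain B' where B': "\<And>s. s \<in> K \<Longrightarrow> norm (f s) \<le> B'"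
    by (auto simp: bounded_iff)
  have glob: "norm (f s) \<le> max B B'" if s: "s \<notin> Lam T" for s
  proof -
    obtain n :: int where n: "\<bar>Re (s + of_real (om T) * of_int n)\<bar> \<le> om T / 2"
      using strip_reduction[OF T] by blast
    define m where "m = - floor (Im s)"
    define t where "t = s + of_real (om T) * of_int n + \<i> * of_int m"
    have tL: "t \<notin> Lam T" using s by (simp add: t_def Lam_add_iff)
    have sL: "s + of_real (om T) * of_int n \<notin> Lam T"
      using s Lam_add_iff[of s T n 0] by simp
    have "norm (f t) = norm (f (s + of_real (om T) * of_int n))"
      unfolding t_def
      using int_periodic[of "- Lam T" "\<lambda>s. norm (f s)" \<i> "s + of_real (om T) * of_int n" m] sL per_i
      by simp
    also have "f (s + of_real (om T) * of_int n) = f s"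
      using int_periodic[of "- Lam T" f "of_real (om T)" s n] s per by simp
    finally have eq: "norm (f t) = norm (f s)" .
    have Ret: "\<bar>Re t\<bar> \<le> om T / 2" using n by (simp add: t_def)
    have Imt: "0 \<le> Im t" "Im t \<le> 1" by (simp_all add: t_def m_def) linarith+
    show ?thesis
    proof (cases "t \<in> ball (\<i> / 2) e")
      case True
      moreover have "t \<noteq> \<i> / 2" using tL i_half_in_Lam by blast
      ultimately have "t \<in> ball (\<i> / 2) e - {\<i> / 2}" by blast
      from bd[OF this] eq show ?thesis by auto
    next
      case False
      hence "t \<in> K" using Ret Imt by (auto simp: K_def in_cbox_complex_iff)
      from B'[OF this] eq show ?thesis by auto
    qed
  qed
  \<comment> \<open>At points of \<open>Lam T\<close> this takes the limits of \<open>f\<close>,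
    whose existence follows from the global bound.\<close>
  define g where "g = remove_sings f"
  have an: "f analytic_on {z}" if "z \<notin> Lam T" for z
    using that holo open_compl_Lam[OF T] by (auto simp: analytic_at)
  have gf: "g z = f z" if "z \<notin> Lam T" for z
    unfolding g_def using an[OF that] by simp
  have gan: "g analytic_on {z}" for z
  proof (cases "z \<in> Lam T")
    case False
    have "g analytic_on {z} \<longleftrightarrow> f analytic_on {z}"
      by (rule analytic_at_cong)
        (use False gf open_compl_Lam[OF T] in \<open>auto intro!: eventually_nhds_in_open[THEN eventually_mono, of "- Lam T"]\<close>)
    thus ?thesis using an[OF False] by simp
  next
    case True
    define d where "d = min (om T) 1"
    have d: "d > 0" using w by (simp add: d_def)
    have sub: "ball z d - {z} \<subseteq> - Lam T" using Lam_isolated[OF T True] by (simp add: d_def)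
    hence hb: "f holomorphic_on ball z d - {z}" using holo holomorphic_on_subset by blast
    have "\<exists>h. h holomorphic_on ball z d \<and> (\<forall>s\<in>ball z d - {z}. h s = f s)"
    proof (subst holomorphic_on_extend_bounded)
      show "\<exists>B. \<forall>\<^sub>F s in at z. norm (f s) \<le> B"
        using glob sub d by (intro exI[of _ "max B B'"])
          (auto simp: eventually_at subset_iff dist_commute intro!: exI[of _ d])
    qed (use d hb in auto)
    then obtain h where h: "h holomorphic_on ball z d" "\<And>s. s \<in> ball z d - {z} \<Longrightarrow> h s = f s" by blast
    have "isCont h z" using h(1) d
      by (metis centre_in_ball continuous_on_eq_continuous_at holomorphic_on_imp_continuous_on open_ball)
    hence "h \<midarrow>z\<rightarrow> h z" by (simp add: isCont_def)
    hence "f \<midarrow>z\<rightarrow> h z"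
      by (rule Lim_transform_within_open[of _ _ _ _ "ball z d"]) (use h d in auto)
    moreover have "isolated_singularity_at f z"
      using hb d by (auto simp: isolated_singularity_at_def analytic_on_open open_Diff intro!: exI[of _ d])
    ultimately show ?thesis unfolding g_def by (intro remove_sings_analytic_at)
  qed
  have ghol: "g holomorphic_on UNIV"
    using gan analytic_on_analytic_at analytic_imp_holomorphic by blast
  have gbd: "norm (g z) \<le> max B B'" for z
  proof (cases "z \<in> Lam T")
    case True
    have "g \<midarrow>z\<rightarrow> g z" using analytic_at_imp_isCont[OF gan] by (simp add: isCont_def)
    moreover have "\<forall>\<^sub>F s in at z. norm (g s) \<le> max B B'"
      using Lam_isolated[OF T True] w glob gf
      by (auto simp: eventually_at subset_iff dist_commute intro!: exI[of _ "min (om T) 1"])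
    ultimately show ?thesis by (intro Lim_norm_ubound[of "at z"]) auto
  qed (use glob gf in auto)
  obtain c where "\<And>z. g z = c"
    using Liouville_theorem[OF ghol] gbd by (auto simp: bounded_iff constant_on_def)
  thus ?thesis using gf by metis
qed


section \<open>Quasiperiodic derivatives and uniqueness for second-order equations\<close>

lemma deriv_quasiperiodic:
  fixes f :: "complex \<Rightarrow> complex"
  assumes S: "open S" and holo: "f holomorphic_on S"
    and q: "\<And>s. s \<in> S \<Longrightarrow> f (s + d) = c * f s" and s: "s \<in> S" "s + d \<in> S"
  shows "deriv f (s + d) = c * deriv f s"
proof -
  have "(f has_field_derivative deriv f (s + d)) (at (s + d))"
    using holo S s holomorphic_derivI by blast
  hence "((\<lambda>x. f (x + d)) has_field_derivative deriv f (s + d)) (at s)"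
    by (simp add: DERIV_shift)
  hence "((\<lambda>x. c * f x) has_field_derivative deriv f (s + d)) (at s)"
    by (rule has_field_derivative_transform_within_open[OF _ S s(1)]) (use q in auto)
  moreover have "((\<lambda>x. c * f x) has_field_derivative c * deriv f s) (at s)"
    using holo S s by (intro DERIV_cmult holomorphic_derivI)
  ultimately show ?thesis by (rule DERIV_unique)
qed

text \<open>By Leibniz's rule the equation expresses the derivative of order \<open>k + 2\<close> at
  \<open>c\<close> through those of order at most \<open>k\<close>. So all derivatives vanish at
  \<open>c\<close>, and the identity theorem applies on the connected set.\<close>

lemma ode_zero_initial_imp_zero:
  fixes U h :: "complex \<Rightarrow> complex"
  assumes S: "open S" "connected S" and holo: "U holomorphic_on S" "h holomorphic_on S"
    and ode: "\<And>s. s \<in> S \<Longrightarrow> deriv (deriv U) s = U s * h s"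
    and c: "c \<in> S" "U c = 0" "deriv U c = 0" and s: "s \<in> S"
  shows "U s = 0"
proof (rule holomorphic_fun_eq_0_on_connected[OF holo(1) S _ c(1) s])
  show "(deriv ^^ n) U c = 0" for n
  proof (induction n rule: less_induct)
    case (less n)
    show ?case
    proof (cases "n < 2")
      case True
      hence "n = 0 \<or> n = 1" by linarith
      thus ?thesis using c by auto
    next
      case False
      then obtain k where n: "n = k + 2" by (metis add.commute le_Suc_ex not_less)
      have "(deriv ^^ n) U c = (deriv ^^ k) (deriv (deriv U)) c"
        by (simp add: n funpow_swap1)
      also have "\<dots> = (deriv ^^ k) (\<lambda>s. U s * h s) c"
        by (rule higher_deriv_cong_ev)
          (use ode S c in \<open>auto intro!: eventually_nhds_in_open[THEN eventually_mono, of S]\<close>)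
      also have "\<dots> = 0"
        by (subst higher_deriv_mult[OF holo S(1) c(1)]) (auto intro!: sum.neutral less.IH simp: n)
      finally show ?thesis .
    qed
  qed
qed

text \<open>The difference of two solutions of the cubic equation thus solves a linear one, whose
  coefficient is the second factor.\<close>

lemma cubic_difference:
  fixes x y k b :: complex
  shows "(k * x ^ 3 + b * x) - (k * y ^ 3 + b * y) = (x - y) * (k * (x\<^sup>2 + x * y + y\<^sup>2) + b)"
  by (simp add: algebra_simps power2_eq_square power3_eq_cube)

locale antiperiodic_elliptic =
  fixes T :: real and f g :: "complex \<Rightarrow> complex" and r :: complex and e :: real
  assumes T: "T > 0" and holo: "f holomorphic_on - Lam T"
    and even: "\<And>s. s \<notin> Lam T \<Longrightarrow> f (- s) = f s"
    and per: "\<And>s. s \<notin> Lam T \<Longrightarrow> f (s + of_real (om T)) = f s"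
    and anti: "\<And>s. s \<notin> Lam T \<Longrightarrow> f (s + \<i>) = - f s"
    and e: "0 < e" "e \<le> min (om T) 1"
    and g: "g holomorphic_on ball (\<i> / 2) e"
    and polar: "\<And>s. s \<in> ball (\<i> / 2) e - {\<i> / 2} \<Longrightarrow> f s = r / (s - \<i> / 2) + g s"
begin

lemma om_pos: "om T > 0" using T by (simp add: om_def)

lemma ball_sub: "ball (\<i> / 2) e - {\<i> / 2} \<subseteq> - Lam T"
  using Lam_isolated[OF T i_half_in_Lam] e subset_ball[OF e(2)] by blast

lemma per_int: "s \<notin> Lam T \<Longrightarrow> f (s + of_real (om T) * of_int n) = f s"
  using int_periodic[of "- Lam T" f "of_real (om T)" s n] per by simp

lemma anti_int: "s \<notin> Lam T \<Longrightarrow> f (s + \<i> * of_int m) = (if Parity.even m then f s else - f s)"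
proof -
  have two: "f (t + 2 * \<i>) = f t" if "t \<notin> Lam T" for t
    using anti[OF that] anti[of "t + \<i>"] that by (simp add: add.assoc)
  have L2: "t + 2 * \<i> \<in> Lam T \<longleftrightarrow> t \<in> Lam T" for t
    using Lam_add_iff[of t T 0 2] by (simp add: mult.commute)
  assume s: "s \<notin> Lam T"
  have ev: "f (t + 2 * \<i> * of_int k) = f t" if "t \<notin> Lam T" for t and k :: int
    using int_periodic[of "- Lam T" f "2 * \<i>" t k] two L2 that by simp
  show ?thesis
  proof (cases "Parity.even m")
    case True
    then obtain k where "m = 2 * k" by blast
    thus ?thesis using ev[OF s, of k] by (simp add: algebra_simps)
  next
    case False
    then obtain k where k: "m = 2 * k + 1" using oddE by blast
    have "f (s + \<i> + 2 * \<i> * of_int k) = - f s" using ev[of "s + \<i>" k] s anti[OF s] by simp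
    moreover have "s + \<i> + 2 * \<i> * of_int k = s + \<i> * of_int m" by (simp add: k algebra_simps)
    ultimately show ?thesis using False by simp
  qed
qed

lemma quasi: "s \<notin> Lam T \<Longrightarrow>
    f (s + of_real (om T) * of_int n + \<i> * of_int m) = (if Parity.even m then f s else - f s)"
  using anti_int[of "s + of_real (om T) * of_int n" m] per_int[of s n] Lam_add_iff[of s T n 0] by simp

lemma deriv_om: "s \<notin> Lam T \<Longrightarrow> deriv f (s + of_real (om T)) = deriv f s"
  using deriv_quasiperiodic[OF open_compl_Lam[OF T] holo, of "of_real (om T)" 1 s] per by simp

lemma deriv_i: "s \<notin> Lam T \<Longrightarrow> deriv f (s + \<i>) = - deriv f s"
  using deriv_quasiperiodic[OF open_compl_Lam[OF T] holo, of \<i> "-1" s] anti by simp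

lemma holo_deriv: "deriv f holomorphic_on - Lam T"
  using holo open_compl_Lam[OF T] by (rule holomorphic_deriv)

lemma deriv2_om: "s \<notin> Lam T \<Longrightarrow> deriv (deriv f) (s + of_real (om T)) = deriv (deriv f) s"
  using deriv_quasiperiodic[OF open_compl_Lam[OF T] holo_deriv, of "of_real (om T)" 1 s] deriv_om by simp

lemma deriv2_i: "s \<notin> Lam T \<Longrightarrow> deriv (deriv f) (s + \<i>) = - deriv (deriv f) s"
  using deriv_quasiperiodic[OF open_compl_Lam[OF T] holo_deriv, of \<i> "-1" s] deriv_i by simp

text \<open>Evenness and antiperiodicity make \<^term>\<open>f\<close> odd about \<^term>\<open>\<i> / 2\<close>.\<close>
lemma regular_part_at_pole: "g (\<i> / 2) = 0"
proof -
  have odd: "g (\<i> - s) = - g s" if s: "s \<in> ball (\<i> / 2) e - {\<i> / 2}" for s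
  proof -
    have s': "\<i> - s \<in> ball (\<i> / 2) e - {\<i> / 2}"
    proof -
      have "dist (\<i> / 2) (\<i> - s) = dist (\<i> / 2) s"
        unfolding dist_norm by (subst norm_minus_commute) (simp add: algebra_simps)
      moreover have "\<i> - s \<noteq> \<i> / 2"
      proof
        assume "\<i> - s = \<i> / 2"
        hence "s = \<i> / 2" by (simp add: algebra_simps)
        thus False using s by simp
      qed
      ultimately show ?thesis using s by auto
    qed
    have sL: "s \<notin> Lam T" using s ball_sub by auto
    have "- s \<notin> Lam T" using sL by simp
    from anti[OF this] even[OF sL] have "f (\<i> - s) = - f s" by (simp add: algebra_simps)
    with polar[OF s] polar[OF s'] have "r / (\<i> - s - \<i> / 2) + g (\<i> - s) = - (r / (s - \<i> / 2)) - g s" by simp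
    moreover have "r / (\<i> - s - \<i> / 2) = - (r / (s - \<i> / 2))"
    proof -
      have "\<i> - s - \<i> / 2 = - (s - \<i> / 2)" by (simp add: field_simps)
      thus ?thesis by (metis minus_divide_right)
    qed
    ultimately show ?thesis by simp
  qed
  have cont: "continuous_on (ball (\<i> / 2) e) g" using g by (rule holomorphic_on_imp_continuous_on)
  hence c1: "isCont g (\<i> / 2)" using e by (simp add: continuous_on_eq_continuous_at)
  have "((\<lambda>s. g (\<i> - s) + g s) \<longlongrightarrow> g (\<i> - \<i> / 2) + g (\<i> / 2)) (at (\<i> / 2))"
    using c1 by (intro tendsto_intros isContD isCont_tendsto_compose[of _ g]) 
      (auto intro!: tendsto_eq_intros)
  moreover have "((\<lambda>s. g (\<i> - s) + g s) \<longlongrightarrow> 0) (at (\<i> / 2))"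
    by (rule tendsto_eventually) (use odd e in \<open>auto simp: eventually_at dist_commute intro!: exI[of _ e]\<close>)
  ultimately have "g (\<i> - \<i> / 2) + g (\<i> / 2) = 0"
    using tendsto_unique[OF at_neq_bot] by blast
  thus ?thesis by simp
qed

text \<open>Liouville's theorem in antiperiodic form: a constant equal to its own negative is zero.
  The function \<open>Y\<close> certifies that \<open>X\<close> has no pole, and it is bounded on
  the compact disc of half the radius.\<close>

lemma bounded_imp_eq_0:
  assumes X: "X holomorphic_on - Lam T"
    and X_per: "\<And>s. s \<notin> Lam T \<Longrightarrow> X (s + of_real (om T)) = X s"
    and X_anti: "\<And>s. s \<notin> Lam T \<Longrightarrow> X (s + \<i>) = - X s"
    and Y: "Y holomorphic_on ball (\<i> / 2) e" "\<And>s. s \<in> ball (\<i> / 2) e - {\<i> / 2} \<Longrightarrow> X s = Y s"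
    and s: "s \<notin> Lam T"
  shows "X s = 0"
proof -
  have "bounded (Y ` cball (\<i> / 2) (e / 2))"
  proof (intro compact_imp_bounded compact_continuous_image)
    show "continuous_on (cball (\<i> / 2) (e / 2)) Y"
      using holomorphic_on_imp_continuous_on[OF Y(1)] e by (rule_tac continuous_on_subset) auto
  qed auto
  then obtain B where B: "\<And>s. s \<in> cball (\<i> / 2) (e / 2) \<Longrightarrow> norm (Y s) \<le> B"
    unfolding bounded_iff by blast
  have "\<exists>c. \<forall>s. s \<notin> Lam T \<longrightarrow> X s = c"
  proof (rule elliptic_liouville[OF T X X_per])
    show "norm (X (s + \<i>)) = norm (X s)" if "s \<notin> Lam T" for s using X_anti[OF that] by simp
    show "norm (X s) \<le> B" if "s \<in> ball (\<i> / 2) (e / 2) - {\<i> / 2}" for s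
      using B[of s] Y(2)[of s] that e by auto
  qed (use e in auto)
  then obtain c where c: "\<And>s. s \<notin> Lam T \<Longrightarrow> X s = c" by blast
  from c[OF s] c[of "s + \<i>"] X_anti[OF s] s show ?thesis by simp
qed

text \<open>Without polar part \<open>g\<close> itself continues \<open>f\<close> across
  \<open>\<i> / 2\<close>. This yields the constant alternative of the theorem.\<close>

lemma eq_0_if_no_pole: "r = 0 \<Longrightarrow> s \<notin> Lam T \<Longrightarrow> f s = 0"
  by (rule bounded_imp_eq_0[OF holo per anti g]) (use polar in auto)

text \<open>Every point of \<open>Lam T\<close> is a translate of \<open>\<i> / 2\<close>; the
  parity of the multiple of \<open>\<i>\<close> decides the sign of the residue.\<close>

lemma shift_polar:
  assumes "z \<in> Lam T"
  obtains r' h where "h holomorphic_on ball z e" "r' = r \<or> r' = - r"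
    "\<And>s. s \<in> ball z e - {z} \<Longrightarrow> f s = r' / (s - z) + h s"
proof -
  obtain n m :: int where z: "z = \<i> / 2 + of_real (om T) * of_int n + \<i> * of_int m"
    using Lam_eq[OF assms] by blast
  define d where "d = of_real (om T) * of_int n + \<i> * of_int m"
  define c where "c = (if Parity.even m then 1 else -1 :: complex)"
  show thesis
  proof
    show "(\<lambda>s. c * g (s - d)) holomorphic_on ball z e"
      by (intro holomorphic_intros holomorphic_on_compose_gen[OF _ g, unfolded o_def])
        (auto simp: d_def z dist_norm algebra_simps)
    show "c * r = r \<or> c * r = - r" by (simp add: c_def)
    show "f s = c * r / (s - z) + c * g (s - d)" if s: "s \<in> ball z e - {z}" for s
    proof -
      have t: "s - d \<in> ball (\<i> / 2) e - {\<i> / 2}"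
      proof -
        have eq: "\<i> / 2 - (s - d) = z - s" by (simp add: z d_def)
        have "s - d \<noteq> \<i> / 2"
        proof
          assume "s - d = \<i> / 2"
          with eq have "z = s" by simp
          with s show False by simp
        qed
        moreover have "dist (\<i> / 2) (s - d) < e" using s unfolding dist_norm eq by (simp add: dist_norm)
        ultimately show ?thesis unfolding mem_ball Diff_iff by blast
      qed
      hence "s - d \<notin> Lam T" using ball_sub by auto
      from quasi[OF this, of n m] have "f s = c * f (s - d)" by (simp add: d_def c_def algebra_simps)
      also have "s - d - \<i> / 2 = s - z" by (simp add: z d_def)
      with polar[OF t] have "f (s - d) = r / (s - z) + g (s - d)" by simp
      finally show ?thesis by (simp add: algebra_simps)
    qed
  qed
qed


text \<open>With \<open>t = s - z\<close> the expansion is \<open>f = r / t + t * k\<close>, because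
  \<open>g\<close> vanishes at \<open>z\<close>. The triple poles of \<open>f''\<close> and of
  \<open>2 * f^3 / r^2\<close> cancel, and \<open>b\<close> is chosen to cancel the simple pole that
  is left; the difference is then antiperiodic without poles, hence zero.\<close>

lemma second_order_ode:
  assumes r: "r \<noteq> 0"
  obtains b where "\<And>s. s \<notin> Lam T \<Longrightarrow> deriv (deriv f) s = 2 / r\<^sup>2 * f s ^ 3 + b * f s"
proof -
  define z where "z = \<i> / 2"
  define k where "k = (\<lambda>s. if s = z then deriv g z else (g s - g z) / (s - z))"
  have gz: "g z = 0" using regular_part_at_pole by (simp add: z_def)
  have k: "k holomorphic_on ball z e" unfolding k_def
    by (rule pole_lemma_open) (use g in \<open>auto simp: z_def\<close>)
  \<comment> \<open>A further Taylor step for \<open>k\<close>, splitting the quotient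
    \<open>6 * k s / t\<close> into the pole \<open>6 * k z / t\<close> and the regular part
    \<open>6 * k2 s\<close>.\<close>
  define k2 where "k2 = (\<lambda>s. if s = z then deriv k z else (k s - k z) / (s - z))"
  have k2: "k2 holomorphic_on ball z e" unfolding k2_def
    by (rule pole_lemma_open) (use k in \<open>auto simp: z_def\<close>)
  define b where "b = - 6 * k z / r"
  \<comment> \<open>What remains of \<open>X\<close> after the polar terms have cancelled, written
    with functions holomorphic on the full disc.\<close>
  define Y where "Y = (\<lambda>s. deriv (deriv g) s - 6 * k2 s - b * g s
      - 2 / r\<^sup>2 * (3 * r * (s - z) * k s ^ 2 + (s - z) ^ 3 * k s ^ 3))"
  define X where "X = (\<lambda>s. deriv (deriv f) s - 2 / r\<^sup>2 * f s ^ 3 - b * f s)"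
  have gb: "g holomorphic_on ball z e" using g by (simp add: z_def)
  have d1: "deriv f s = - r / (s - z)\<^sup>2 + deriv g s" if s: "s \<in> ball z e - {z}" for s
  proof -
    have "((\<lambda>s. r / (s - z) + g s) has_field_derivative (- r / (s - z)\<^sup>2 + deriv g s)) (at s)"
      using s holomorphic_derivI[OF gb open_ball, of s]
      by (auto intro!: derivative_eq_intros simp: power2_eq_square)
    hence "(f has_field_derivative (- r / (s - z)\<^sup>2 + deriv g s)) (at s)"
      by (rule has_field_derivative_transform_within_open[of _ _ _ "ball z e - {z}"])
        (use s polar in \<open>auto simp: z_def open_Diff simp del: eq_divide_eq_numeral1\<close>)
    thus ?thesis by (rule DERIV_imp_deriv)
  qed
  have dgb: "deriv g holomorphic_on ball z e" using gb by (intro holomorphic_deriv) auto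
  have d2: "deriv (deriv f) s = 2 * r / (s - z) ^ 3 + deriv (deriv g) s" if s: "s \<in> ball z e - {z}" for s
  proof -
    define t where "t = s - z"
    have t: "t \<noteq> 0" "2 * s - 2 * z = 2 * t" using s by (auto simp: t_def)
    have "((\<lambda>s. - r / (s - z)\<^sup>2 + deriv g s) has_field_derivative
        (r * (2 * s - 2 * z) / ((s - z)\<^sup>2 * (s - z)\<^sup>2) + deriv (deriv g) s)) (at s)"
      using s holomorphic_derivI[OF dgb open_ball, of s]
      by (auto intro!: derivative_eq_intros simp: power2_eq_square)
    also have "r * (2 * s - 2 * z) / ((s - z)\<^sup>2 * (s - z)\<^sup>2) = 2 * r / (s - z) ^ 3"
      unfolding t t_def[symmetric] using t(1) by (simp add: power2_eq_square power3_eq_cube mult_ac)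
    finally have "(deriv f has_field_derivative (2 * r / (s - z) ^ 3 + deriv (deriv g) s)) (at s)"
      by (rule has_field_derivative_transform_within_open[of _ _ _ "ball z e - {z}"])
        (use s d1 in \<open>auto simp: open_Diff\<close>)
    thus ?thesis by (rule DERIV_imp_deriv)
  qed
  have Y: "Y holomorphic_on ball z e" unfolding Y_def
    by (intro holomorphic_intros gb k k2 holomorphic_deriv dgb) (use r in auto)
  have XY: "X s = Y s" if s: "s \<in> ball z e - {z}" for s
  proof -
    define t where "t = s - z"
    have t: "t \<noteq> 0" using s by (simp add: t_def)
    have gk: "g s = t * k s" using s gz by (simp add: k_def t_def)
    have kk: "k s = k z + t * k2 s" using s by (simp add: k2_def t_def)
    have fs: "f s = r / t + g s" using polar[of s] s by (simp add: z_def t_def)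
    have bb: "b * r = - 6 * k z" using r by (simp add: b_def)
    have "X s = 2 * r / t ^ 3 + deriv (deriv g) s - 2 / r\<^sup>2 * (r / t + t * k s) ^ 3 - b * (r / t + t * k s)"
      using d2[OF s] by (simp add: X_def fs gk t_def)
    also have "2 / r\<^sup>2 * (r / t + t * k s) ^ 3 = 2 * r / t ^ 3 + 6 * k s / t
        + 2 / r\<^sup>2 * (3 * r * t * k s ^ 2 + t ^ 3 * k s ^ 3)"
      using r t by (simp add: field_simps power2_eq_square power3_eq_cube)
    also have "6 * k s / t = 6 * k z / t + 6 * k2 s" using t by (simp add: kk field_simps)
    also have "b * (r / t + t * k s) = - 6 * k z / t + b * g s"
      using bb by (simp add: gk algebra_simps)
    finally show ?thesis by (simp add: Y_def t_def)
  qed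
  have "X s = 0" if "s \<notin> Lam T" for s
  proof (rule bounded_imp_eq_0[OF _ _ _ _ _ that])
    show "X holomorphic_on - Lam T" unfolding X_def
      by (intro holomorphic_intros holo holomorphic_deriv holo_deriv open_compl_Lam T) (use r in auto)
    show "X (s + of_real (om T)) = X s" if "s \<notin> Lam T" for s
      unfolding X_def using deriv2_om[OF that] per[OF that] by simp
    show "X (s + \<i>) = - X s" if "s \<notin> Lam T" for s
      unfolding X_def using deriv2_i[OF that] anti[OF that] by simp
    show "Y holomorphic_on ball (\<i> / 2) e" using Y by (simp add: z_def)
    show "X s = Y s" if "s \<in> ball (\<i> / 2) e - {\<i> / 2}" for s
      using XY that unfolding z_def by blast
  qed
  thus thesis by (intro that[of b]) (simp add: X_def algebra_simps)
qed

text \<open>Energy conservation: multiplying the equation by \<open>2 * deriv f s\<close> gives a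
  total derivative. The constant is the same everywhere because the complement of the countable set
  \<open>Lam T\<close> is connected.\<close>

lemma first_integral:
  assumes r: "r \<noteq> 0"
    and ode: "\<And>s. s \<notin> Lam T \<Longrightarrow> deriv (deriv f) s = 2 / r\<^sup>2 * f s ^ 3 + b * f s"
  obtains c where "\<And>s. s \<notin> Lam T \<Longrightarrow> (deriv f s)\<^sup>2 = f s ^ 4 / r\<^sup>2 + b * (f s)\<^sup>2 + c"
proof -
  define k where "k = 1 / r\<^sup>2"
  define V where "V = (\<lambda>s. (deriv f s)\<^sup>2 - k * f s ^ 4 - b * (f s)\<^sup>2)"
  have "(V has_field_derivative 0) (at s)" if s: "s \<in> - Lam T" for s
  proof -
    have "(f has_field_derivative deriv f s) (at s)"
      using holo s open_compl_Lam[OF T] holomorphic_derivI by blast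
    moreover have "(deriv f has_field_derivative deriv (deriv f) s) (at s)"
      using holo_deriv s open_compl_Lam[OF T] holomorphic_derivI by blast
    ultimately have "(V has_field_derivative (2 * deriv f s * deriv (deriv f) s
        - k * (4 * f s ^ 3 * deriv f s) - b * (2 * f s * deriv f s))) (at s)"
      unfolding V_def using r by (auto intro!: derivative_eq_intros)
    moreover have "2 * deriv f s * deriv (deriv f) s
        - k * (4 * f s ^ 3 * deriv f s) - b * (2 * f s * deriv f s) = 0"
      using ode[of s] s by (simp add: k_def algebra_simps)
    ultimately show ?thesis by simp
  qed
  hence "\<exists>c. \<forall>s\<in>- Lam T. V s = c"
    using DERIV_zero_connected_constant[OF connected_compl_countable[OF countable_Lam] open_compl_Lam[OF T] finite.emptyI]
    by (metis DERIV_isCont Diff_empty continuous_at_imp_continuous_on)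
  then obtain c where "\<And>s. s \<notin> Lam T \<Longrightarrow> V s = c" by auto
  thus thesis by (intro that[of c]) (force simp: V_def k_def algebra_simps)
qed

text \<open>A period carries the pole \<open>\<i> / 2\<close> to a pole, so it is an integer
  combination of \<open>om T\<close> and \<open>\<i>\<close>. An odd multiple of \<open>\<i>\<close>
  would give \<open>f = - f\<close> and hence no pole.\<close>

lemma period_imp_Mlat:
  assumes r: "r \<noteq> 0" and d: "\<And>s. s \<notin> Lam T \<Longrightarrow> s + d \<notin> Lam T \<Longrightarrow> f (s + d) = f s"
  shows "d \<in> Mlat T"
proof -
  have "\<i> / 2 + d \<in> Lam T"
  proof (rule ccontr)
    assume n: "\<i> / 2 + d \<notin> Lam T"
    obtain \<epsilon> where \<epsilon>: "\<epsilon> > 0" "ball (\<i> / 2 + d) \<epsilon> \<subseteq> - Lam T"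
      using open_compl_Lam[OF T] n open_contains_ball by (metis ComplI)
    have "isCont f (\<i> / 2 + d)" using n holo open_compl_Lam[OF T]
      by (metis ComplI continuous_on_eq_continuous_at holomorphic_on_imp_continuous_on)
    hence "((\<lambda>s. f (s + d)) \<longlongrightarrow> f (\<i> / 2 + d)) (at (\<i> / 2))"
      by (rule isCont_tendsto_compose) (auto intro!: tendsto_eq_intros)
    \<comment> \<open>If \<open>\<i> / 2 + d\<close> is regular, this product tends to 0, whereas
      periodicity makes it equal to \<open>(s - \<i> / 2) * f s\<close>, which tends to
      \<open>r\<close>.\<close>
    hence "((\<lambda>s. (s - \<i> / 2) * f (s + d)) \<longlongrightarrow> (\<i> / 2 - \<i> / 2) * f (\<i> / 2 + d)) (at (\<i> / 2))"
      by (intro tendsto_intros)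
    moreover have "\<forall>\<^sub>F s in at (\<i> / 2). (s - \<i> / 2) * f (s + d) = r + (s - \<i> / 2) * g s"
      unfolding eventually_at
    proof (intro exI[of _ "min e \<epsilon>"] conjI ballI impI)
      fix s assume s: "s \<noteq> \<i> / 2 \<and> dist s (\<i> / 2) < min e \<epsilon>"
      have s1: "s \<in> ball (\<i> / 2) e - {\<i> / 2}" using s by (simp add: dist_commute)
      have "s + d \<in> ball (\<i> / 2 + d) \<epsilon>" using s by (simp add: dist_norm norm_minus_commute)
      hence "s + d \<notin> Lam T" using \<epsilon> by blast
      with d[of s] s1 ball_sub have "f (s + d) = f s" by auto
      thus "(s - \<i> / 2) * f (s + d) = r + (s - \<i> / 2) * g s"
        using polar[OF s1] s by (simp add: distrib_left)
    qed (use e \<epsilon> in auto)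
    ultimately have "((\<lambda>s. r + (s - \<i> / 2) * g s) \<longlongrightarrow> 0) (at (\<i> / 2))"
      by (auto intro: Lim_transform_eventually)
    moreover have "isCont g (\<i> / 2)" using holomorphic_on_imp_continuous_on[OF g] e
      by (simp add: continuous_on_eq_continuous_at)
    hence "((\<lambda>s. r + (s - \<i> / 2) * g s) \<longlongrightarrow> r + (\<i> / 2 - \<i> / 2) * g (\<i> / 2)) (at (\<i> / 2))"
      by (intro tendsto_intros isContD)
    ultimately show False using r tendsto_unique[OF at_neq_bot] by fastforce
  qed
  then obtain n m :: int where nm: "\<i> / 2 + d = \<i> / 2 + of_real (om T) * of_int n + \<i> * of_int m"
    using Lam_eq by blast
  hence dd: "d = of_real (om T) * of_int n + \<i> * of_int m" by (simp add: add.assoc)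
  have "Parity.even m"
  proof (rule ccontr)
    assume odd: "odd m"
    have z: "f s = 0" if s: "s \<notin> Lam T" for s
    proof -
      have "s + d \<notin> Lam T" using Lam_add_iff[of s T n m] s by (simp add: dd add.assoc)
      from d[OF s this] quasi[OF s, of n m] odd have "f s = - f s" by (simp add: dd add.assoc)
      thus ?thesis by simp
    qed
    have "((\<lambda>s. r + (s - \<i> / 2) * g s) \<longlongrightarrow> 0) (at (\<i> / 2))"
    proof (rule tendsto_eventually)
      show "\<forall>\<^sub>F s in at (\<i> / 2). r + (s - \<i> / 2) * g s = 0"
        unfolding eventually_at
      proof (intro exI[of _ e] conjI ballI impI)
        fix s assume s: "s \<noteq> \<i> / 2 \<and> dist s (\<i> / 2) < e"
        have s1: "s \<in> ball (\<i> / 2) e - {\<i> / 2}" using s by (simp add: dist_commute)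
        have "f s = 0" using z s1 ball_sub by auto
        with polar[OF s1] have "(s - \<i> / 2) * (r / (s - \<i> / 2) + g s) = 0" by simp
        thus "r + (s - \<i> / 2) * g s = 0" using s by (simp add: distrib_left)
      qed (use e in auto)
    qed
    moreover have "isCont g (\<i> / 2)" using holomorphic_on_imp_continuous_on[OF g] e
      by (simp add: continuous_on_eq_continuous_at)
    hence "((\<lambda>s. r + (s - \<i> / 2) * g s) \<longlongrightarrow> r + (\<i> / 2 - \<i> / 2) * g (\<i> / 2)) (at (\<i> / 2))"
      by (intro tendsto_intros isContD)
    ultimately show False using r tendsto_unique[OF at_neq_bot] by fastforce
  qed
  then obtain k where "m = 2 * k" by blast
  hence "d = of_real (om T) * of_int n + 2 * \<i> * of_int k" by (simp add: dd)
  thus ?thesis unfolding Mlat_def by blast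
qed

text \<open>The function \<open>f (s + d) - f s\<close> with \<open>d = a - c\<close> solves a
  linear second-order equation and vanishes to first order at \<open>c\<close>. It is therefore
  identically zero, and \<open>d\<close> is a period.\<close>

lemma same_initial_data_imp_Mlat:
  assumes r: "r \<noteq> 0" and a: "a \<notin> Lam T" and c: "c \<notin> Lam T"
    and eq: "f a = f c" "deriv f a = deriv f c"
  shows "a - c \<in> Mlat T"
proof -
  obtain b where ode: "\<And>s. s \<notin> Lam T \<Longrightarrow> deriv (deriv f) s = 2 / r\<^sup>2 * f s ^ 3 + b * f s"
    using second_order_ode[OF r] by blast
  define d where "d = a - c"
  \<comment> \<open>Both terms of the difference are holomorphic here; only countably many points
    are removed, so the set stays connected.\<close>
  define S where "S = - (Lam T \<union> (\<lambda>z. z - d) ` Lam T)"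
  have S_iff: "s \<in> S \<longleftrightarrow> s \<notin> Lam T \<and> s + d \<notin> Lam T" for s
    unfolding S_def by (force simp: image_iff)
  have conn: "connected S" unfolding S_def
    by (intro connected_compl_countable countable_Un countable_image countable_Lam)
  have "closed ((\<lambda>z. z - d) ` Lam T)"
    using closed_translation_subtract[OF closed_Lam[OF T], of d] by simp
  hence op: "open S" unfolding S_def using closed_Lam[OF T] by (intro open_Compl closed_Un)
  define U where "U = (\<lambda>s. f (s + d) - f s)"
  define h where "h = (\<lambda>s. 2 / r\<^sup>2 * ((f (s + d))\<^sup>2 + f (s + d) * f s + (f s)\<^sup>2) + b)"
  have hf: "f holomorphic_on S" using holo by (rule holomorphic_on_subset) (auto simp: S_iff)
  have hfd: "(\<lambda>s. f (s + d)) holomorphic_on S"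
    by (rule holomorphic_on_compose_gen[OF _ holo, unfolded o_def]) (auto simp: S_iff intro!: holomorphic_intros)
  have dU: "deriv U s = deriv f (s + d) - deriv f s" if s: "s \<in> S" for s
  proof -
    have "(f has_field_derivative deriv f (s + d)) (at (s + d))"
      using s holomorphic_derivI[OF holo open_compl_Lam[OF T]] by (auto simp: S_iff)
    moreover have "(f has_field_derivative deriv f s) (at s)"
      using s holomorphic_derivI[OF holo open_compl_Lam[OF T]] by (auto simp: S_iff)
    ultimately show ?thesis unfolding U_def
      by (intro DERIV_imp_deriv derivative_intros) (auto simp: DERIV_shift)
  qed
  have ddU: "deriv (deriv U) s = U s * h s" if s: "s \<in> S" for s
  proof -
    have 1: "(deriv f has_field_derivative deriv (deriv f) (s + d)) (at (s + d))"
      using s holomorphic_derivI[OF holo_deriv open_compl_Lam[OF T]] by (auto simp: S_iff)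
    have 2: "(deriv f has_field_derivative deriv (deriv f) s) (at s)"
      using s holomorphic_derivI[OF holo_deriv open_compl_Lam[OF T]] by (auto simp: S_iff)
    have "((\<lambda>s. deriv f (s + d) - deriv f s) has_field_derivative
        deriv (deriv f) (s + d) - deriv (deriv f) s) (at s)"
      using 1 2 by (intro derivative_intros) (auto simp: DERIV_shift)
    hence "(deriv U has_field_derivative deriv (deriv f) (s + d) - deriv (deriv f) s) (at s)"
      by (rule has_field_derivative_transform_within_open[OF _ op s]) (use dU in auto)
    hence "deriv (deriv U) s = deriv (deriv f) (s + d) - deriv (deriv f) s" by (rule DERIV_imp_deriv)
    also have "\<dots> = U s * h s"
    proof -
      show ?thesis using s ode[of s] ode[of "s + d"] cubic_difference[of "2 / r\<^sup>2" "f (s + d)" b "f s"]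
        by (simp add: S_iff U_def h_def)
    qed
    finally show ?thesis .
  qed
  have "f (s + d) = f s" if "s \<notin> Lam T" "s + d \<notin> Lam T" for s
  proof -
    have cS: "c \<in> S" using a c by (simp add: S_iff d_def)
    have "U s = 0"
    proof (rule ode_zero_initial_imp_zero[OF op conn _ _ ddU cS])
      show "U holomorphic_on S" unfolding U_def by (intro holomorphic_intros hf hfd)
      show "h holomorphic_on S" unfolding h_def by (intro holomorphic_intros hf hfd) (use r in auto)
      show "U c = 0" using eq by (simp add: U_def d_def)
      show "deriv U c = 0" using dU[OF cS] eq by (simp add: d_def)
    qed (use that in \<open>auto simp: S_iff\<close>)
    thus ?thesis by (simp add: U_def)
  qed
  from period_imp_Mlat[OF r this] show ?thesis by (simp add: d_def)
qed


lemma not_Mlat_half: "Re d = om T / 2 \<Longrightarrow> d \<notin> Mlat T"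
proof
  assume d: "Re d = om T / 2" "d \<in> Mlat T"
  then obtain m n :: int where "d = of_real (om T) * of_int m + 2 * \<i> * of_int n"
    by (auto simp: Mlat_def)
  with d have "om T * real_of_int m = om T * (1/2)" by simp
  hence "real_of_int m = 1/2" using om_pos by (simp only: mult_cancel_left) auto
  hence "2 * m = 1" by linarith
  thus False by presburger
qed

lemma Im_int_not_Lam: "Im s = of_int k \<Longrightarrow> s \<notin> Lam T"
proof
  assume s: "Im s = of_int k" "s \<in> Lam T"
  then obtain n m :: int where "s = of_real (om T) * of_int n + \<i> * (of_int m + 1/2)"
    by (auto simp: Lam_iff)
  with s have "real_of_int k = real_of_int m + 1/2" by simp
  hence "2 * k = 2 * m + 1" by linarith
  thus False by presburger
qed

text \<open>Evenness together with the period \<open>2 * h\<close> makes \<open>f\<close> symmetric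
  about \<open>h\<close>, so its derivative there equals its own negative.\<close>

lemma half_period_critical:
  assumes h: "h \<notin> Lam T" "2 * h \<in> Mlat T"
  shows "deriv f h = 0"
proof -
  obtain m n :: int where nm: "2 * h = of_real (om T) * of_int m + 2 * \<i> * of_int n"
    using h by (auto simp: Mlat_def)
  have refl: "f (2 * h - s) = f s" if "s \<in> - Lam T" for s
  proof -
    \<comment> \<open>The multiple of \<open>\<i>\<close> is displayed as even, so
      \<open>quasi\<close> gives no sign.\<close>
    have "2 * h - s = - s + of_real (om T) * of_int m + \<i> * of_int (2 * n)"
      unfolding nm by (simp add: algebra_simps)
    hence "f (2 * h - s) = f (- s + of_real (om T) * of_int m + \<i> * of_int (2 * n))"
      by (rule arg_cong)
    also have "\<dots> = f s" using that by (subst quasi) (auto simp: even)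
    finally show ?thesis .
  qed
  have "(f has_field_derivative deriv f h) (at (2 * h - h))"
    using holomorphic_derivI[OF holo open_compl_Lam[OF T], of h] h by simp
  hence "((\<lambda>s. f (2 * h - s)) has_field_derivative deriv f h * (- 1)) (at h)"
    by (rule DERIV_chain2) (auto intro!: derivative_eq_intros)
  hence "(f has_field_derivative deriv f h * (- 1)) (at h)"
    by (rule has_field_derivative_transform_within_open[OF _ open_compl_Lam[OF T]]) (use refl h in auto)
  hence "deriv f h = deriv f h * (- 1)" by (rule DERIV_imp_deriv)
  thus ?thesis by simp
qed

text \<open>If the second derivative also vanished at \<open>a\<close>, then \<open>f a\<close>
  would be a constant solution of the differential equation. By uniqueness \<open>f\<close> would be
  constant.\<close>

lemma critical_points_simple:
  assumes r: "r \<noteq> 0" and a: "a \<notin> Lam T" "deriv f a = 0"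
  shows "deriv (deriv f) a \<noteq> 0"
proof
  assume a2: "deriv (deriv f) a = 0"
  obtain b where ode: "\<And>s. s \<notin> Lam T \<Longrightarrow> deriv (deriv f) s = 2 / r\<^sup>2 * f s ^ 3 + b * f s"
    using second_order_ode[OF r] by blast
  define U where "U = (\<lambda>s. f s - f a)"
  define h where "h = (\<lambda>s. 2 / r\<^sup>2 * ((f s)\<^sup>2 + f s * f a + (f a)\<^sup>2) + b)"
  have op: "open (- Lam T)" using open_compl_Lam[OF T] .
  have dU: "deriv U s = deriv f s" if s: "s \<in> - Lam T" for s
    unfolding U_def using holomorphic_derivI[OF holo op s]
    by (intro DERIV_imp_deriv) (auto intro!: derivative_eq_intros)
  have ddU: "deriv (deriv U) s = U s * h s" if s: "s \<in> - Lam T" for s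
  proof -
    have "deriv (deriv U) s = deriv (deriv f) s"
      by (rule deriv_cong_ev) (use dU op s in \<open>auto intro!: eventually_nhds_in_open[THEN eventually_mono, of "- Lam T"]\<close>)
    thus ?thesis
      using s ode[of s] ode[OF a(1)] a2 cubic_difference[of "2 / r\<^sup>2" "f s" b "f a"] by (simp add: U_def h_def)
  qed
  have U0: "U s = 0" if "s \<notin> Lam T" for s
  proof (rule ode_zero_initial_imp_zero[OF op connected_compl_countable[OF countable_Lam] _ _ ddU])
    show "U holomorphic_on - Lam T" unfolding U_def by (intro holomorphic_intros holo)
    show "h holomorphic_on - Lam T" unfolding h_def by (intro holomorphic_intros holo) (use r in auto)
    show "a \<in> - Lam T" "U a = 0" using a by (auto simp: U_def)
    show "deriv U a = 0" using dU a by simp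
  qed (use that in auto)
  \<comment> \<open>A constant function has every number as a period, in particular
    \<open>om T / 2\<close>, which is not in the lattice.\<close>
  hence "of_real (om T) / 2 \<in> Mlat T"
    by (intro period_imp_Mlat[OF r]) (metis U_def right_minus_eq)
  thus False using not_Mlat_half by simp
qed

text \<open>At a critical point the first integral is a quadratic equation for the square of
  \<open>f\<close>. The points \<open>0\<close> and \<open>om T / 2\<close> supply its two roots,
  and their shifts by \<open>\<i>\<close> supply the opposite signs of \<open>f\<close>; so the
  first-order data at any critical point occur at one of the four half periods.\<close>

lemma critical_points:
  assumes r: "r \<noteq> 0"
  shows "{s. s \<notin> Lam T \<and> deriv f s = 0}
    = {c + z | c z. c \<in> {0, of_real (om T) / 2, of_real (om T) / 2 + \<i>, \<i>} \<and> z \<in> Mlat T}" (is "?L = ?R")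
proof
  let ?w = "of_real (om T) :: complex"
  have half: "c + z \<notin> Lam T \<and> deriv f (c + z) = 0" if c: "c \<in> {0, ?w / 2, ?w / 2 + \<i>, \<i>}" and z: "z \<in> Mlat T" for c z
  proof -
    obtain m n :: int where nm: "z = ?w * of_int m + 2 * \<i> * of_int n"
      using z by (auto simp: Mlat_def)
    have "\<exists>j\<in>{0, 1}. \<exists>k\<in>{0, 1}. 2 * c = ?w * of_int j + 2 * \<i> * of_int k"
      using c by (auto simp: mult.commute[of c 2])
    then obtain j k :: int where jk: "2 * c = ?w * of_int j + 2 * \<i> * of_int k" by blast
    have "Im (2 * c) = 2 * of_int k" by (simp add: jk)
    hence "Im c = of_int k" by simp
    hence "Im (c + z) = of_int (k + 2 * n)" by (simp add: nm)
    hence 1: "c + z \<notin> Lam T" by (rule Im_int_not_Lam)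
    have "2 * (c + z) = ?w * of_int (j + 2 * m) + 2 * \<i> * of_int (k + 2 * n)"
      using jk by (simp add: nm algebra_simps)
    hence "2 * (c + z) \<in> Mlat T" unfolding Mlat_def by blast
    with 1 half_period_critical show ?thesis by blast
  qed
  show "?R \<subseteq> ?L" using half by blast
  have z0: "0 \<in> Mlat T" unfolding Mlat_def by (auto intro!: exI[of _ 0])
  have h0: "0 \<notin> Lam T" "deriv f 0 = 0" using half[of 0, OF _ z0] by auto
  have h1: "?w / 2 \<notin> Lam T" "deriv f (?w / 2) = 0" using half[of "?w / 2", OF _ z0] by auto
  have h2: "?w / 2 + \<i> \<notin> Lam T" "deriv f (?w / 2 + \<i>) = 0" using half[of "?w / 2 + \<i>", OF _ z0] by auto
  have h3: "\<i> \<notin> Lam T" "deriv f \<i> = 0" using half[of \<i>, OF _ z0] by auto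
  have f3: "f \<i> = - f 0" using anti[OF h0(1)] by simp
  have f2: "f (?w / 2 + \<i>) = - f (?w / 2)" using anti[OF h1(1)] .
  \<comment> \<open>Equal squares would give \<open>om T / 2\<close> the same first-order data as
    \<open>0\<close> or as \<open>\<i>\<close>, forcing a lattice element with real part
    \<open>om T / 2\<close>.\<close>
  have distinct: "(f 0)\<^sup>2 \<noteq> (f (?w / 2))\<^sup>2"
  proof
    assume "(f 0)\<^sup>2 = (f (?w / 2))\<^sup>2"
    hence "f (?w / 2) = f 0 \<or> f (?w / 2) = f \<i>" by (auto simp: power2_eq_iff f3)
    hence "?w / 2 - 0 \<in> Mlat T \<or> ?w / 2 - \<i> \<in> Mlat T"
      using same_initial_data_imp_Mlat[OF r h1(1) h0(1)] same_initial_data_imp_Mlat[OF r h1(1) h3(1)] h0 h1 h3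
      by auto
    thus False using not_Mlat_half[of "?w / 2 - 0"] not_Mlat_half[of "?w / 2 - \<i>"] by auto
  qed
  obtain b where ode: "\<And>s. s \<notin> Lam T \<Longrightarrow> deriv (deriv f) s = 2 / r\<^sup>2 * f s ^ 3 + b * f s"
    using second_order_ode[OF r] by blast
  obtain c where int: "\<And>s. s \<notin> Lam T \<Longrightarrow> (deriv f s)\<^sup>2 = f s ^ 4 / r\<^sup>2 + b * (f s)\<^sup>2 + c"
    using first_integral[OF r ode] by blast
  have root: "((f s)\<^sup>2)\<^sup>2 + r\<^sup>2 * b * (f s)\<^sup>2 + r\<^sup>2 * c = 0" if "s \<notin> Lam T" "deriv f s = 0" for s
  proof -
    have "r\<^sup>2 * (f s ^ 4 / r\<^sup>2 + b * (f s)\<^sup>2 + c) = 0" using int[OF that(1)] that(2) by simp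
    moreover have "r\<^sup>2 * (f s ^ 4 / r\<^sup>2) = ((f s)\<^sup>2)\<^sup>2" using r by simp
    ultimately show ?thesis by (simp add: distrib_left mult.assoc)
  qed
  show "?L \<subseteq> ?R"
  proof
    fix a assume "a \<in> ?L"
    hence a: "a \<notin> Lam T" "deriv f a = 0" by auto
    define x where "x = (f a)\<^sup>2"
    define x0 where "x0 = (f 0)\<^sup>2"
    define x1 where "x1 = (f (?w / 2))\<^sup>2"
    define B where "B = r\<^sup>2 * b"
    define C where "C = r\<^sup>2 * c"
    have e: "x\<^sup>2 + B * x + C = 0" "x0\<^sup>2 + B * x0 + C = 0" "x1\<^sup>2 + B * x1 + C = 0"
      using root[OF a] root[OF h0] root[OF h1] by (simp_all add: x_def x0_def x1_def B_def C_def)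
    \<comment> \<open>Vieta's formula: since the roots \<open>x0\<close> and \<open>x1\<close> are
      distinct, their sum is \<open>- B\<close> and the quadratic factors completely.\<close>
    have "(x1 - x0) * (x1 + x0 + B) = (x1\<^sup>2 + B * x1 + C) - (x0\<^sup>2 + B * x0 + C)"
      by (simp add: algebra_simps power2_eq_square)
    also have "\<dots> = 0" unfolding e by simp
    finally have "x1 + x0 + B = 0" using distinct by (simp add: x0_def x1_def)
    hence B: "B = - (x0 + x1)" by (simp add: eq_neg_iff_add_eq_0 algebra_simps)
    have "(x - x0) * (x - x1) = (x\<^sup>2 + B * x + C) - (x0\<^sup>2 + B * x0 + C)"
      by (simp add: B algebra_simps power2_eq_square)
    hence "x = x0 \<or> x = x1" using e by simp
    hence "\<exists>h\<in>{0, ?w / 2, ?w / 2 + \<i>, \<i>}. f a = f h \<and> h \<notin> Lam T \<and> deriv f h = 0"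
      unfolding x_def x0_def x1_def power2_eq_iff using h0 h1 h2 h3 f2 f3 by auto
    then obtain h where h: "h \<in> {0, ?w / 2, ?w / 2 + \<i>, \<i>}" "f a = f h" "h \<notin> Lam T" "deriv f h = 0" by blast
    have "a - h \<in> Mlat T" using same_initial_data_imp_Mlat[OF r a(1) h(3) h(2)] a(2) h(4) by simp
    moreover have "a = h + (a - h)" by simp
    ultimately show "a \<in> ?R" using h(1) by blast
  qed
qed

text \<open>Near \<open>z\<close> the function \<open>(s - z) * D s\<close> extends holomorphically
  with the value \<open>r\<close> or \<open>- r\<close> at \<open>z\<close>, hence nonzero; the
  constant \<open>c\<close> only changes the regular part.\<close>

lemma simple_pole_at_Lam:
  assumes r: "r \<noteq> 0" and D: "\<And>s. s \<notin> Lam T \<Longrightarrow> D s = c + f s" and z: "z \<in> Lam T"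
  shows "is_pole D z" "zorder D z = -1"
proof -
  obtain r' h where h: "h holomorphic_on ball z e" "r' = r \<or> r' = - r"
    "\<And>s. s \<in> ball z e - {z} \<Longrightarrow> f s = r' / (s - z) + h s"
    by (rule shift_polar[OF z]) blast
  define k where "k = (\<lambda>s. r' + (s - z) * (c + h s))"
  have k: "k holomorphic_on ball z e" unfolding k_def by (intro holomorphic_intros h(1))
  have kz: "k z \<noteq> 0" using h(2) r by (auto simp: k_def)
  have sub: "ball z e - {z} \<subseteq> - Lam T" using Lam_isolated[OF T z] subset_ball[OF e(2)] by blast
  have D_quot: "D s = k s / (s - z)" if s: "s \<in> ball z e - {z}" for s
  proof -
    have "D s = c + (r' / (s - z) + h s)" using D[of s] h(3)[OF s] sub s by auto
    thus ?thesis using s by (simp add: k_def add_divide_distrib)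
  qed
  show "zorder D z = -1"
    by (rule zorder_eqI[of "ball z e" z k]) (use e k kz D_quot in \<open>auto simp: divide_inverse power_int_minus\<close>)
  have "is_pole (\<lambda>s. k s / (s - z) ^ 1) z"
    by (rule is_pole_basic[of k "ball z e"]) (use e k kz in auto)
  moreover have ev: "\<forall>\<^sub>F s in at z. D s = k s / (s - z) ^ 1"
    unfolding eventually_at using e D_quot by (intro exI[of _ e]) (auto simp: dist_commute)
  ultimately show "is_pole D z" using is_pole_cong[OF ev refl] by simp
qed

text \<open>Evenness transports the expansion at \<open>\<i> / 2\<close> to
  \<open>- \<i> / 2\<close>, and the substitution of \<open>- s\<close> reverses the sign of the
  polar term. Computing residues as limits covers \<open>r = 0\<close> as well.\<close>

lemma residues_opposite:
  assumes D: "\<And>s. s \<notin> Lam T \<Longrightarrow> D s = c + f s"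
  shows "residue D (\<i> / 2) = - residue D (- \<i> / 2)"
proof -
  have cg: "isCont g (\<i> / 2)" using holomorphic_on_imp_continuous_on[OF g] e
    by (simp add: continuous_on_eq_continuous_at)
  have Dh: "D holomorphic_on - Lam T"
    by (rule holomorphic_transform[of "\<lambda>s. c + f s"]) (use D in \<open>auto intro!: holomorphic_intros holo\<close>)
  have lim: "((\<lambda>s. r + (s - \<i> / 2) * (c + g s)) \<longlongrightarrow> r + (\<i> / 2 - \<i> / 2) * (c + g (\<i> / 2))) (at (\<i> / 2))"
    using cg by (intro tendsto_intros isContD)
  have 1: "((\<lambda>s. D s * (s - \<i> / 2)) \<longlongrightarrow> r) (at (\<i> / 2))"
  proof (rule Lim_transform_eventually)
    show "((\<lambda>s. r + (s - \<i> / 2) * (c + g s)) \<longlongrightarrow> r) (at (\<i> / 2))" using lim by simp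
    show "\<forall>\<^sub>F s in at (\<i> / 2). r + (s - \<i> / 2) * (c + g s) = D s * (s - \<i> / 2)"
      unfolding eventually_at
    proof (intro exI[of _ e] conjI ballI impI)
      fix s assume s: "s \<noteq> \<i> / 2 \<and> dist s (\<i> / 2) < e"
      hence s1: "s \<in> ball (\<i> / 2) e - {\<i> / 2}" by (simp add: dist_commute)
      have "D s = c + (r / (s - \<i> / 2) + g s)" using D[of s] polar[OF s1] ball_sub s1 by auto
      moreover define t where "t = s - \<i> / 2"
      moreover have "t \<noteq> 0" using s by (simp add: t_def)
      ultimately show "r + (s - \<i> / 2) * (c + g s) = D s * (s - \<i> / 2)"
        unfolding t_def[symmetric] by (simp add: field_simps)
    qed (use e in auto)
  qed
  have mL: "- \<i> / 2 \<in> Lam T" using i_half_in_Lam[of T] Lam_uminus[of "\<i> / 2" T] by simp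
  have 2: "((\<lambda>s. D s * (s - (- \<i> / 2))) \<longlongrightarrow> - r) (at (- \<i> / 2))"
  proof (rule Lim_transform_eventually)
    have "((\<lambda>s. g (- s)) \<longlongrightarrow> g (\<i> / 2)) (at (- \<i> / 2))"
      using cg by (rule isCont_tendsto_compose) (auto intro!: tendsto_eq_intros)
    hence "((\<lambda>s. - r + (s - (- \<i> / 2)) * (c + g (- s))) \<longlongrightarrow> - r + (- \<i> / 2 - (- \<i> / 2)) * (c + g (\<i> / 2)))
        (at (- \<i> / 2))"
      by (intro tendsto_intros)
    thus "((\<lambda>s. - r + (s - (- \<i> / 2)) * (c + g (- s))) \<longlongrightarrow> - r) (at (- \<i> / 2))" by simp
    show "\<forall>\<^sub>F s in at (- \<i> / 2). - r + (s - (- \<i> / 2)) * (c + g (- s)) = D s * (s - (- \<i> / 2))"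
      unfolding eventually_at
    proof (intro exI[of _ e] conjI ballI impI)
      fix s assume s: "s \<noteq> - \<i> / 2 \<and> dist s (- \<i> / 2) < e"
      define t where "t = s - (- \<i> / 2)"
      have t: "t \<noteq> 0" "- s - \<i> / 2 = - t"
        using s unfolding t_def right_minus_eq by (blast, simp)
      have "dist (\<i> / 2) (- s) = dist s (- \<i> / 2)" by (simp add: dist_norm algebra_simps)
      moreover have "- s \<noteq> \<i> / 2" using t by (metis diff_self neg_equal_0_iff_equal)
      ultimately have s1: "- s \<in> ball (\<i> / 2) e - {\<i> / 2}" using s by simp
      hence "- s \<notin> Lam T" using ball_sub by blast
      hence "D s = c + (r / (- s - \<i> / 2) + g (- s))" using D[of s] polar[OF s1] even[of s] by simp
      thus "- r + (s - (- \<i> / 2)) * (c + g (- s)) = D s * (s - (- \<i> / 2))"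
        unfolding t_def[symmetric] t(2) using t(1) by (simp add: field_simps)
    qed (use e in auto)
  qed
  have "residue D (\<i> / 2) = r"
  proof (rule residue_simple'[OF _ _ _ 1])
    show "D holomorphic_on ball (\<i> / 2) e - {\<i> / 2}" using Dh ball_sub by (rule holomorphic_on_subset)
  qed (use e in auto)
  moreover have "residue D (- \<i> / 2) = - r"
  proof (rule residue_simple'[OF _ _ _ 2])
    from Lam_isolated[OF T mL]
    show "D holomorphic_on ball (- \<i> / 2) (min (om T) 1) - {- \<i> / 2}"
      using Dh by (rule_tac holomorphic_on_subset)
  qed (use om_pos in auto)
  ultimately show ?thesis by simp
qed

lemma critical_points_translate:
  assumes r: "r \<noteq> 0" and D: "\<And>s. s \<notin> Lam T \<Longrightarrow> D s = c + f s"
  shows "{s. s \<notin> Lam T \<and> deriv D s = 0}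
      = {c + z | c z. c \<in> {0, of_real (om T) / 2, of_real (om T) / 2 + \<i>, \<i>} \<and> z \<in> Mlat T}"
    and "s \<notin> Lam T \<Longrightarrow> deriv D s = 0 \<Longrightarrow> deriv (deriv D) s \<noteq> 0"
proof -
  have op: "open (- Lam T)" using open_compl_Lam[OF T] .
  have d1: "deriv D s = deriv f s" if "s \<notin> Lam T" for s
  proof -
    have "((\<lambda>s. c + f s) has_field_derivative deriv f s) (at s)"
      using holomorphic_derivI[OF holo op, of s] that by (auto intro!: derivative_eq_intros)
    hence "(D has_field_derivative deriv f s) (at s)"
      by (rule has_field_derivative_transform_within_open[OF _ op]) (use that D in auto)
    thus ?thesis by (rule DERIV_imp_deriv)
  qed
  have d2: "deriv (deriv D) s = deriv (deriv f) s" if "s \<notin> Lam T" for s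
    by (rule deriv_cong_ev)
      (use d1 op that in \<open>auto intro!: eventually_nhds_in_open[THEN eventually_mono, of "- Lam T"]\<close>)
  have "{s. s \<notin> Lam T \<and> deriv D s = 0} = {s. s \<notin> Lam T \<and> deriv f s = 0}" using d1 by auto
  thus "{s. s \<notin> Lam T \<and> deriv D s = 0}
      = {c + z | c z. c \<in> {0, of_real (om T) / 2, of_real (om T) / 2 + \<i>, \<i>} \<and> z \<in> Mlat T}"
    using critical_points[OF r] by simp
  show "deriv (deriv D) s \<noteq> 0" if "s \<notin> Lam T" "deriv D s = 0"
    using critical_points_simple[OF r that(1)] d1[OF that(1)] d2[OF that(1)] that(2) by simp
qed

end

text \<open>Evenness and the period \<open>2 * \<i>\<close> give
  \<open>D (s + \<i>) = D (\<i> - s)\<close>, the reflection of \<open>D\<close> about the pole. In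
  \<open>D s + D (s + \<i>)\<close> the polar parts therefore cancel, the sum is constant, and
  subtracting half of that constant from \<open>D\<close> makes it antiperiodic.\<close>

lemma even_elliptic_split:
  fixes D :: "complex \<Rightarrow> complex"
  assumes T: "T > 0" and holo: "D holomorphic_on - Lam T"
    and even: "\<And>s. s \<notin> Lam T \<Longrightarrow> D (- s) = D s"
    and per: "\<And>s. s \<notin> Lam T \<Longrightarrow> D (s + of_real (om T)) = D s"
    and per2: "\<And>s. s \<notin> Lam T \<Longrightarrow> D (s + 2 * \<i>) = D s"
    and e0: "e0 > 0" "\<And>s. s \<in> ball (\<i> / 2) e0 - {\<i> / 2} \<Longrightarrow> norm ((s - \<i> / 2) * D s) \<le> B"
  obtains c r g e where "antiperiodic_elliptic T (\<lambda>s. D s - c) g r e"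
proof -
  define e where "e = min e0 (min (om T) 1)"
  have e: "e > 0" "e \<le> min (om T) 1" "e \<le> e0" using e0 T by (auto simp: e_def om_def)
  have sub: "ball (\<i> / 2) e - {\<i> / 2} \<subseteq> - Lam T"
    using Lam_isolated[OF T i_half_in_Lam] subset_ball[OF e(2)] by blast
  have bd: "norm ((s - \<i> / 2) * D s) \<le> B" if "s \<in> ball (\<i> / 2) e - {\<i> / 2}" for s
    using e0(2)[of s] that subset_ball[OF e(3)] by blast
  obtain r g where g: "g holomorphic_on ball (\<i> / 2) e"
    "\<And>s. s \<in> ball (\<i> / 2) e - {\<i> / 2} \<Longrightarrow> D s = r / (s - \<i> / 2) + g s"
    using simple_pole_split[OF e(1) holomorphic_on_subset[OF holo sub] bd] by blast
  define E where "E = (\<lambda>s. D s + D (s + \<i>))"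
  have refl: "\<i> - s \<in> ball (\<i> / 2) e' - {\<i> / 2}" if s: "s \<in> ball (\<i> / 2) e' - {\<i> / 2}" for s e'
  proof -
    have eq: "\<i> / 2 - (\<i> - s) = s - \<i> / 2" by (simp add: field_simps)
    have "\<i> - s \<noteq> \<i> / 2"
    proof
      assume "\<i> - s = \<i> / 2"
      with eq have "s = \<i> / 2" by simp
      with s show False by simp
    qed
    moreover have "dist (\<i> / 2) (\<i> - s) < e'"
      using s unfolding dist_norm eq by (simp add: dist_norm norm_minus_commute)
    ultimately show ?thesis unfolding mem_ball Diff_iff by blast
  qed
  have Eg: "E s = g s + g (\<i> - s)" if s: "s \<in> ball (\<i> / 2) e - {\<i> / 2}" for s
  proof -
    have sL: "s \<notin> Lam T" using s sub by blast
    have "\<i> - s \<notin> Lam T" using refl[OF s] sub by blast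
    hence "D (s - \<i>) = D (\<i> - s)" using even[of "\<i> - s"] by simp
    moreover have "s - \<i> \<notin> Lam T" using sL Lam_add_i[of "s - \<i>" T] by simp
    hence "D (s + \<i>) = D (s - \<i>)" using per2[of "s - \<i>"] by (simp add: algebra_simps)
    ultimately have "E s = r / (s - \<i> / 2) + g s + (r / (\<i> - s - \<i> / 2) + g (\<i> - s))"
      using g(2)[OF s] g(2)[OF refl[OF s]] by (simp add: E_def)
    moreover have "r / (\<i> - s - \<i> / 2) = - (r / (s - \<i> / 2))"
    proof -
      have "\<i> - s - \<i> / 2 = - (s - \<i> / 2)" by (simp add: field_simps)
      thus ?thesis by (metis minus_divide_right)
    qed
    ultimately show ?thesis by simp
  qed
  have "bounded (g ` cball (\<i> / 2) (e / 2))"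
  proof (intro compact_imp_bounded compact_continuous_image)
    show "continuous_on (cball (\<i> / 2) (e / 2)) g"
      using holomorphic_on_imp_continuous_on[OF g(1)] e by (rule_tac continuous_on_subset) auto
  qed auto
  then obtain K where K: "\<And>s. s \<in> cball (\<i> / 2) (e / 2) \<Longrightarrow> norm (g s) \<le> K"
    unfolding bounded_iff by blast
  have Ebd: "norm (E s) \<le> K + K" if s: "s \<in> ball (\<i> / 2) (e / 2) - {\<i> / 2}" for s
  proof -
    have "s \<in> ball (\<i> / 2) e - {\<i> / 2}" using s subset_ball[of "e / 2" e "\<i> / 2"] e by auto
    from Eg[OF this] have "norm (E s) \<le> norm (g s) + norm (g (\<i> - s))" by (simp add: norm_triangle_ineq)
    also have "\<dots> \<le> K + K"
      using s refl[OF s] ball_subset_cball[of "\<i> / 2" "e / 2"] by (intro add_mono K) blast+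
    finally show ?thesis .
  qed
  have hD: "(\<lambda>s. D (s + \<i>)) holomorphic_on - Lam T"
    by (rule holomorphic_on_compose_gen[OF _ holo, unfolded o_def]) (auto intro!: holomorphic_intros)
  have "\<exists>c. \<forall>s. s \<notin> Lam T \<longrightarrow> E s = c"
  proof (rule elliptic_liouville[OF T _ _ _ half_gt_zero[OF e(1)] Ebd])
    show "E holomorphic_on - Lam T" unfolding E_def by (intro holomorphic_intros holo hD)
    show "E (s + of_real (om T)) = E s" if "s \<notin> Lam T" for s
    proof -
      have "s + \<i> \<notin> Lam T" using that by simp
      from per[OF this] per[OF that] show ?thesis by (simp add: E_def add_ac)
    qed
    show "norm (E (s + \<i>)) = norm (E s)" if "s \<notin> Lam T" for s
      using per2[OF that] by (simp add: E_def add_ac)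
  qed
  then obtain c' where c': "\<And>s. s \<notin> Lam T \<Longrightarrow> E s = c'" by blast
  define c where "c = c' / 2"
  have "antiperiodic_elliptic T (\<lambda>s. D s - c) (\<lambda>s. g s - c) r e"
  proof
    show "(\<lambda>s. D s - c) holomorphic_on - Lam T" "(\<lambda>s. g s - c) holomorphic_on ball (\<i> / 2) e"
      by (intro holomorphic_intros holo g(1); simp)+
    show "D (s + \<i>) - c = - (D s - c)" if "s \<notin> Lam T" for s
    proof -
      have "D s + D (s + \<i>) = 2 * c" using c'[OF that] by (simp add: E_def c_def)
      hence "D (s + \<i>) = 2 * c - D s" by (metis add_diff_cancel_left')
      thus ?thesis by simp
    qed
    show "D s - c = r / (s - \<i> / 2) + (g s - c)" if "s \<in> ball (\<i> / 2) e - {\<i> / 2}" for s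
      using g(2)[OF that] by simp
  qed (use T even per e in auto)
  thus thesis by (rule that)
qed

section \<open>The conjugated kernel\<close>

text \<open>This is \<open>pi / cosh (pi * x)\<close> at \<open>x = s + w * n\<close>, the value of
  the product of \<open>Gamma (1/2 + \<i> * x)\<close> and \<open>Gamma (1/2 - \<i> * x)\<close>.
  The form with \<open>cos\<close> suits the reflection formula.\<close>

definition sech_shift :: "real \<Rightarrow> int \<Rightarrow> complex \<Rightarrow> complex" where
  "sech_shift w n s = of_real pi / cos (\<i> * of_real pi * (s + of_real w * of_int n))"

definition kern :: "real \<Rightarrow> (int \<Rightarrow> complex) \<Rightarrow> complex \<Rightarrow> complex \<Rightarrow> int \<Rightarrow> int \<Rightarrow> complex" where
  "kern w q lam s n m = sech_shift w n s / lam * q (n - m)"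

text \<open>Cutting off the coefficients is the same as restricting the Toeplitz factor to a band,
  so \<open>HNmat\<close> has the same conjugated form as \<open>Hmat\<close>.\<close>

definition trunc :: "nat \<Rightarrow> (int \<Rightarrow> complex) \<Rightarrow> int \<Rightarrow> complex" where
  "trunc N q l = (if \<bar>l\<bar> \<le> int N then q l else 0)"

text \<open>The reciprocal Gamma factor is the denominator of \<open>Beta\<close>: its two arguments
  in \<open>Hmat\<close> add up to \<open>1 - \<i> * om T * (n - m)\<close>, independently of
  \<open>s\<close>.\<close>

definition qcoef :: "(real \<Rightarrow> real) \<Rightarrow> real \<Rightarrow> int \<Rightarrow> complex" where
  "qcoef p T l = ptilde p T l * rGamma (1 - \<i> * of_real (om T) * of_int l)"

lemma cos_nonzero:
  assumes "s \<notin> Lam T"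
  shows "cos (\<i> * of_real pi * (s + of_real (om T) * of_int n)) \<noteq> 0"
proof
  assume "cos (\<i> * of_real pi * (s + of_real (om T) * of_int n)) = 0"
  then obtain k :: int where "\<i> * of_real pi * (s + of_real (om T) * of_int n)
      = complex_of_real (k * pi) + of_real pi / 2"
    unfolding cos_eq_0 by blast
  also have "\<dots> = of_real pi * (of_int k + 1/2)" by (simp add: algebra_simps)
  finally have "of_real pi * (\<i> * (s + of_real (om T) * of_int n)) = of_real pi * (of_int k + 1/2 :: complex)"
    by (simp only: mult_ac)
  hence "\<i> * (s + of_real (om T) * of_int n) = of_int k + 1/2" by (simp only: mult_cancel_left) simp
  hence "\<i> * (\<i> * (s + of_real (om T) * of_int n)) = \<i> * (of_int k + 1/2)" by simp
  hence h: "- (s + of_real (om T) * of_int n) = \<i> * (of_int k + 1/2)" by simp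
  have "s = - (- (s + of_real (om T) * of_int n)) - of_real (om T) * of_int n" by simp
  also have "\<dots> = of_real (om T) * of_int (- n) + \<i> * (of_int (- k - 1) + 1/2)"
    unfolding h by (simp add: algebra_simps)
  finally have "s = of_real (om T) * of_int (- n) + \<i> * (of_int (- k - 1) + 1/2)" .
  thus False using assms unfolding Lam_iff by blast
qed

lemma sech_shift_nonzero: "s \<notin> Lam T \<Longrightarrow> sech_shift (om T) n s \<noteq> 0"
  using cos_nonzero by (simp add: sech_shift_def)

lemma sech_shift_shift: "sech_shift w n (s + of_real w) = sech_shift w (n + 1) s"
  by (simp add: sech_shift_def algebra_simps)

lemma sech_shift_uminus: "sech_shift w n (- s) = sech_shift w (- n) s"
proof -
  have "\<i> * of_real pi * (- s + of_real w * of_int n) = - (\<i> * of_real pi * (s + of_real w * of_int (- n)))"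
    by (simp add: algebra_simps)
  thus ?thesis by (simp only: sech_shift_def cos_minus)
qed

lemma sech_shift_add_i: "sech_shift w n (s + \<i>) = - sech_shift w n s"
proof -
  have "\<i> * of_real pi * (s + \<i> + of_real w * of_int n) = \<i> * of_real pi * (s + of_real w * of_int n) - of_real pi"
    by (simp add: algebra_simps)
  thus ?thesis by (simp only: sech_shift_def cos_diff) simp
qed

lemma cnj_sech_shift: "cnj (sech_shift w n s) = sech_shift w n (cnj s)"
proof -
  have "cnj (\<i> * of_real pi * (s + of_real w * of_int n)) = - (\<i> * of_real pi * (cnj s + of_real w * of_int n))"
    by simp
  thus ?thesis by (simp only: sech_shift_def complex_cnj_divide cnj_cos cos_minus complex_cnj_complex_of_real)
qed

lemma holomorphic_sech_shift [holomorphic_intros]: "sech_shift (om T) n holomorphic_on - Lam T"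
  unfolding sech_shift_def[abs_def] by (intro holomorphic_intros) (use cos_nonzero in auto)

text \<open>The modulus of \<open>cos z\<close> is at least that of \<open>sinh (Im z)\<close>. For
  \<open>n\<close> different from 0 the strip keeps the real part of \<open>s + w * n\<close> at
  distance at least \<open>w / 4\<close> from zero; row 0 is excluded because it carries the poles
  in the strip.\<close>

lemma sech_shift_bound:
  assumes w: "w > 0"
  obtains C where "C \<ge> 1"
    "\<And>n s. n \<noteq> 0 \<Longrightarrow> \<bar>Re s\<bar> \<le> 3 * w / 4 \<Longrightarrow> norm (sech_shift w n s) \<le> C * exp (- pi * w * \<bar>real_of_int n\<bar>)"
proof -
  define y0 where "y0 = pi * w / 4"
  have y0: "y0 > 0" using w by (simp add: y0_def)
  \<comment> \<open>Chosen so that \<open>sinh y\<close> is at least \<open>c * exp y\<close> for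
    all \<open>y \<ge> y0\<close>.\<close>
  define c where "c = (1 - exp (- 2 * y0)) / 2"
  have c: "c > 0" using y0 by (simp add: c_def)
  define C where "C = pi / c * exp (3 * pi * w / 4)"
  have "norm (sech_shift w n s) \<le> C * exp (- pi * w * \<bar>real_of_int n\<bar>)" if n: "n \<noteq> 0" and s: "\<bar>Re s\<bar> \<le> 3 * w / 4" for n s
  proof -
    define z where "z = \<i> * of_real pi * (s + of_real w * of_int n)"
    define y where "y = \<bar>Im z\<bar>"
    have Imz: "Im z = pi * (Re s + w * real_of_int n)" by (simp add: z_def algebra_simps)
    have "\<bar>Re s + w * real_of_int n\<bar> \<ge> w * \<bar>real_of_int n\<bar> - 3 * w / 4"
    proof -
      have "\<bar>w * real_of_int n\<bar> \<le> \<bar>Re s + w * real_of_int n\<bar> + \<bar>Re s\<bar>" by linarith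
      thus ?thesis using s w by (simp add: abs_mult)
    qed
    hence "pi * (w * \<bar>real_of_int n\<bar> - 3 * w / 4) \<le> pi * \<bar>Re s + w * real_of_int n\<bar>"
      by (intro mult_left_mono) auto
    moreover have "y = pi * \<bar>Re s + w * real_of_int n\<bar>" unfolding y_def Imz by (simp add: abs_mult)
    ultimately have y1: "y \<ge> pi * w * \<bar>real_of_int n\<bar> - 3 * pi * w / 4"
      by (simp add: right_diff_distrib mult_ac)
    have "\<bar>real_of_int n\<bar> \<ge> 1" using n by linarith
    hence "pi * w * \<bar>real_of_int n\<bar> \<ge> pi * w * 1" using w by (intro mult_left_mono) auto
    with y1 have y2: "y \<ge> y0" unfolding y0_def by linarith
    have sq: "(exp (Im z) - inverse (exp (Im z)))\<^sup>2 = (exp y - exp (- y))\<^sup>2"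
      unfolding y_def by (cases "Im z \<ge> 0") (auto simp: exp_minus power2_commute)
    have "((exp y - exp (- y)) / 2)\<^sup>2 \<le> (norm (cos z))\<^sup>2"
      unfolding norm_cos_squared sq by (simp add: power_divide)
    hence "(exp y - exp (- y)) / 2 \<le> norm (cos z)" by (rule power2_le_imp_le) simp
    moreover have "c * exp y \<le> (exp y - exp (- y)) / 2"
    proof -
      have "exp (- y) = exp (- 2 * y) * exp y" by (simp add: exp_add[symmetric])
      also have "\<dots> \<le> exp (- 2 * y0) * exp y" using y2 by simp
      finally have "exp (- y) \<le> exp (- 2 * y0) * exp y" .
      moreover have "c * exp y = (exp y - exp (- 2 * y0) * exp y) / 2"
        by (simp add: c_def left_diff_distrib)
      ultimately show ?thesis by simp
    qed
    ultimately have "c * exp y \<le> norm (cos z)" by linarith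
    hence "norm (sech_shift w n s) \<le> pi / (c * exp y)"
      using c unfolding sech_shift_def z_def[symmetric] norm_divide by (intro frac_le) auto
    also have "\<dots> = pi / c * exp (- y)" by (simp add: exp_minus divide_inverse)
    also have "\<dots> \<le> pi / c * exp (3 * pi * w / 4 - pi * w * \<bar>real_of_int n\<bar>)"
      using y1 c by (intro mult_left_mono) auto
    also have "\<dots> = C * exp (- pi * w * \<bar>real_of_int n\<bar>)"
      by (simp add: C_def mult_exp_exp)
    finally show ?thesis .
  qed
  \<comment> \<open>Making the constant at least 1 lets the same constant serve for row 0 in
    \<open>minor_domination\<close>.\<close>
  hence "norm (sech_shift w n s) \<le> max 1 C * exp (- pi * w * \<bar>real_of_int n\<bar>)" if "n \<noteq> 0" "\<bar>Re s\<bar> \<le> 3 * w / 4" for n s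
    using that by (meson order.trans max.cobounded2 mult_right_mono exp_ge_zero)
  thus thesis by (intro that[of "max 1 C"]) auto
qed

section \<open>Symmetries of the Fredholm determinant in conjugated form\<close>

lemma norm_trunc_le: "norm (trunc N q l) \<le> norm (q l)"
  by (simp add: trunc_def)

text \<open>Adding the period moves each row factor to the next index, and the Toeplitz factor is
  unchanged by a common index shift.\<close>

lemma fredholm_kern_shift:
  "fredholm_det_I_minus (kern w q lam (s + of_real w)) = fredholm_det_I_minus (kern w q lam s)"
proof -
  have "kern w q lam (s + of_real w) = (\<lambda>n m. kern w q lam s (n + 1) (m + 1))"
    by (simp add: kern_def sech_shift_shift fun_eq_iff)
  moreover have "bij (\<lambda>n::int. n + 1)" by (rule bij_betw_byWitness[of _ "\<lambda>n. n - 1"]) auto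
  ultimately show ?thesis using fredholm_det_reindex by simp
qed

text \<open>Reflecting the indices yields the row factors at \<open>- s\<close> but transposes the
  Toeplitz factor. Transposing back puts the row factors on the columns, and conjugation with these
  factors returns them to the rows.\<close>

lemma fredholm_kern_uminus:
  assumes s: "s \<notin> Lam T"
  shows "fredholm_det_I_minus (kern (om T) q lam (- s)) = fredholm_det_I_minus (kern (om T) q lam s)"
proof -
  let ?K = "\<lambda>n m. kern (om T) q lam s (- n) (- m)"
  let ?d = "\<lambda>n. sech_shift (om T) (- n) s"
  have "fredholm_det_I_minus (kern (om T) q lam (- s)) = fredholm_det_I_minus ?K"
  proof (rule fredholm_det_cong)
    fix S :: "int set" assume S: "finite S"
    have "pminor (kern (om T) q lam (- s)) S = pminor (\<lambda>n m. ?d n * ?K m n / ?d m) S"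
      using sech_shift_nonzero[OF s] by (intro pminor_cong) (simp add: kern_def sech_shift_uminus)
    also have "\<dots> = pminor (\<lambda>n m. ?K m n) S" using sech_shift_nonzero[OF s] by (rule pminor_diagonal_conjugation)
    also have "\<dots> = pminor ?K S" using S by (rule pminor_transpose)
    finally show "pminor (kern (om T) q lam (- s)) S = pminor ?K S" .
  qed
  also have "\<dots> = fredholm_det_I_minus (kern (om T) q lam s)"
    by (rule fredholm_det_reindex) (rule bij_betw_byWitness[of _ uminus]; auto)
  finally show ?thesis .
qed

text \<open>The symmetry of \<open>q\<close> makes conjugation transpose the Toeplitz factor;
  transposition and diagonal conjugation then restore the kernel as in the evenness
  argument.\<close>

lemma cnj_fredholm_kern:
  assumes s: "s \<notin> Lam T" and q: "\<And>l. cnj (q l) = q (- l)"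
  shows "cnj (fredholm_det_I_minus (kern (om T) q lam s)) = fredholm_det_I_minus (kern (om T) q (cnj lam) (cnj s))"
  unfolding cnj_fredholm_det
proof (rule fredholm_det_cong)
  fix S :: "int set" assume S: "finite S"
  let ?K = "kern (om T) q (cnj lam) (cnj s)"
  let ?d = "\<lambda>n. sech_shift (om T) n (cnj s)"
  have d: "?d n \<noteq> 0" for n using sech_shift_nonzero[of "cnj s"] s by simp
  have "pminor (\<lambda>n m. cnj (kern (om T) q lam s n m)) S = pminor (\<lambda>n m. ?d n * ?K m n / ?d m) S"
    using d by (intro pminor_cong) (simp add: kern_def cnj_sech_shift q)
  also have "\<dots> = pminor (\<lambda>n m. ?K m n) S" using d by (rule pminor_diagonal_conjugation)
  also have "\<dots> = pminor ?K S" using S by (rule pminor_transpose)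
  finally show "pminor (\<lambda>n m. cnj (kern (om T) q lam s n m)) S = pminor ?K S" .
qed

lemma fredholm_kern_add_i:
  "fredholm_det_I_minus (kern w q lam (s + \<i>)) = fredholm_det_I_minus (kern w q (- lam) s)"
  by (simp add: kern_def[abs_def] sech_shift_add_i)

text \<open>The row Gamma factor of \<open>Beta\<close> joins \<open>d n\<close> in the reflection
  formula, the column Gamma factor cancels against \<open>d m\<close>, and the denominator is
  absorbed into \<open>qcoef\<close>.\<close>

lemma Hmat_eq_conjugated_kern:
  assumes s: "s \<notin> Lam T"
  defines "d \<equiv> (\<lambda>n::int. Gamma (1/2 + \<i> * of_real (om T) * of_int n + \<i> * s))"
  shows "d n \<noteq> 0" "d n * (Hmat p T s n m / lam) / d m = kern (om T) (qcoef p T) lam s n m"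
proof -
  show nz: "d n \<noteq> 0" for n
  proof -
    \<comment> \<open>\<open>Gamma\<close> is assigned the value 0 at its poles and vanishes nowhere
      else, so nonvanishing amounts to avoiding the poles.\<close>
    have "1/2 + \<i> * of_real (om T) * of_int n + \<i> * s \<notin> \<int>\<^sub>\<le>\<^sub>0"
    proof
      assume "1/2 + \<i> * of_real (om T) * of_int n + \<i> * s \<in> \<int>\<^sub>\<le>\<^sub>0"
      then obtain k :: int where "1/2 + \<i> * of_real (om T) * of_int n + \<i> * s = of_int k"
        by (metis nonpos_Ints_cases)
      hence "\<i> * (1/2 + \<i> * of_real (om T) * of_int n + \<i> * s) = \<i> * of_int k" by simp
      hence "s = of_real (om T) * of_int (- n) + \<i> * (of_int (- k) + 1/2)"
        by (simp add: algebra_simps)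
      thus False using s unfolding Lam_iff by blast
    qed
    thus ?thesis by (simp add: d_def Gamma_eq_zero_iff)
  qed
  define x where "x = s + of_real (om T) * of_int n"
  have "d n * Gamma (1/2 - \<i> * of_real (om T) * of_int n - \<i> * s)
      = Gamma (1/2 + \<i> * x) * Gamma (1 - (1/2 + \<i> * x))"
    by (simp add: d_def x_def algebra_simps)
  also have "\<dots> = of_real pi / sin (of_real pi * (1/2 + \<i> * x))"
    by (rule Gamma_reflection_complex)
  also have "of_real pi * (1/2 + \<i> * x) = of_real (pi / 2) + \<i> * of_real pi * x"
    by (simp add: algebra_simps)
  also have "sin (of_real (pi / 2) + \<i> * of_real pi * x) = cos (\<i> * of_real pi * x)"
    unfolding sin_add sin_of_real cos_of_real by simp
  finally have D: "d n * Gamma (1/2 - \<i> * of_real (om T) * of_int n - \<i> * s) = sech_shift (om T) n s"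
    by (simp add: sech_shift_def x_def)
  have e: "(1/2 - \<i> * of_real (om T) * of_int n - \<i> * s) + (1/2 + \<i> * of_real (om T) * of_int m + \<i> * s)
      = 1 - \<i> * of_real (om T) * of_int (n - m)" by (simp add: algebra_simps)
  have "Hmat p T s n m = Gamma (1/2 - \<i> * of_real (om T) * of_int n - \<i> * s) * d m * qcoef p T (n - m)"
    unfolding Hmat_def Beta_def e qcoef_def d_def
    by (simp only: rGamma_inverse_Gamma divide_inverse mult_ac)
  hence "d n * (Hmat p T s n m / lam) / d m
      = (d n * Gamma (1/2 - \<i> * of_real (om T) * of_int n - \<i> * s)) / lam * qcoef p T (n - m)"
    using nz[of m] by simp
  thus "d n * (Hmat p T s n m / lam) / d m = kern (om T) (qcoef p T) lam s n m"
    unfolding D kern_def .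
qed

lemma fredholm_Hmat:
  assumes s: "s \<notin> Lam T"
  shows "fredholm_det_I_minus (\<lambda>n m. Hmat p T s n m / lam) = fredholm_det_I_minus (kern (om T) (qcoef p T) lam s)"
proof (rule fredholm_det_cong)
  fix S :: "int set"
  let ?d = "\<lambda>n::int. Gamma (1/2 + \<i> * of_real (om T) * of_int n + \<i> * s)"
  have "pminor (kern (om T) (qcoef p T) lam s) S = pminor (\<lambda>n m. ?d n * (Hmat p T s n m / lam) / ?d m) S"
    by (intro pminor_cong Hmat_eq_conjugated_kern(2)[OF s, symmetric])
  also have "\<dots> = pminor (\<lambda>n m. Hmat p T s n m / lam) S"
    by (rule pminor_diagonal_conjugation) (rule Hmat_eq_conjugated_kern(1)[OF s])
  finally show "pminor (\<lambda>n m. Hmat p T s n m / lam) S = pminor (kern (om T) (qcoef p T) lam s) S" by simp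
qed

lemma DeltaN_eq:
  assumes s: "s \<notin> Lam T"
  shows "DeltaN p T N lam s = fredholm_det_I_minus (kern (om T) (trunc N (qcoef p T)) lam s)"
  unfolding DeltaN_def
proof (rule fredholm_det_cong)
  fix S :: "int set"
  let ?d = "\<lambda>n::int. Gamma (1/2 + \<i> * of_real (om T) * of_int n + \<i> * s)"
  have "kern (om T) (trunc N (qcoef p T)) lam s n m = ?d n * (HNmat p T N s n m / lam) / ?d m" for n m
    using Hmat_eq_conjugated_kern(2)[OF s, of n p m lam] by (auto simp: HNmat_def kern_def trunc_def)
  hence "pminor (kern (om T) (trunc N (qcoef p T)) lam s) S = pminor (\<lambda>n m. ?d n * (HNmat p T N s n m / lam) / ?d m) S"
    by (intro pminor_cong)
  also have "\<dots> = pminor (\<lambda>n m. HNmat p T N s n m / lam) S"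
    by (rule pminor_diagonal_conjugation) (rule Hmat_eq_conjugated_kern(1)[OF s])
  finally show "pminor (\<lambda>n m. HNmat p T N s n m / lam) S = pminor (kern (om T) (trunc N (qcoef p T)) lam s) S" by simp
qed

section \<open>Symmetry and growth of the coefficients\<close>

lemma cnj_qcoef: "cnj (qcoef p T l) = qcoef p T (- l)"
proof -
  have "cnj (ptilde p T l) = ptilde p T (- l)"
    unfolding ptilde_def complex_cnj_mult integral_cnj by (simp add: exp_cnj)
  thus ?thesis by (simp add: qcoef_def cnj_rGamma)
qed

text \<open>On the imaginary axis the reflection formula gives the modulus of the reciprocal Gamma
  function exactly, of order \<open>exp (pi * w * \<bar>l\<bar> / 2) / sqrt \<bar>l\<bar>\<close>.
  The factor \<open>1 + \<bar>l\<bar>\<close> leaves the square root of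
  \<open>\<bar>l\<bar>\<close>, which is where the exponent \<open>1/4\<close> comes from.\<close>

lemma rGamma_bound:
  fixes w :: real
  assumes w: "w > 0"
  obtains C where "C \<ge> 0" "\<And>l::int. norm (rGamma (1 - \<i> * of_real w * of_int l))
      * ((1 + \<bar>real_of_int l\<bar>) * exp (- (pi * w / 2) * \<bar>real_of_int l\<bar>)) \<le> C * (1 + (real_of_int l)\<^sup>2) powr (1/4)"
proof -
  \<comment> \<open>The summand \<open>4 / (pi * w)\<close> comes from bounding \<open>1 + L\<close>
    by \<open>2 * L\<close>; the summand 1 covers \<open>l = 0\<close>.\<close>
  define C where "C = sqrt (1 + 4 / (pi * w))"
  have C: "C \<ge> 1" "C\<^sup>2 = 1 + 4 / (pi * w)" using w by (auto simp: C_def)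
  have "norm (rGamma (1 - \<i> * of_real w * of_int l))
      * ((1 + \<bar>real_of_int l\<bar>) * exp (- (pi * w / 2) * \<bar>real_of_int l\<bar>)) \<le> C * (1 + (real_of_int l)\<^sup>2) powr (1/4)" (is "?x \<le> ?y") for l :: int
  proof (cases "l = 0")
    case True
    thus ?thesis using C by simp
  next
    case False
    define L where "L = \<bar>real_of_int l\<bar>"
    have L: "L \<ge> 1" using False by (simp add: L_def)
    define z where "z = \<i> * of_real w * (of_int l :: complex)"
    have z0: "z \<noteq> 0" using False w by (simp add: z_def)
    have nz: "norm z = w * L" using w by (simp add: z_def norm_mult L_def)
    \<comment> \<open>For imaginary \<open>z\<close> the two arguments are complex conjugates, so
      the reflection formula determines the square of a single modulus.\<close>
    have "norm (rGamma (1 + z)) = norm (rGamma (1 - z))"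
    proof -
      have "rGamma (1 + z) = cnj (rGamma (1 - z))" by (simp add: cnj_rGamma z_def)
      thus ?thesis by simp
    qed
    moreover have "norm z * norm (rGamma (1 + z)) = norm (rGamma z)"
      using rGamma_plus1[of z] by (metis add.commute norm_mult)
    ultimately have "norm z * (norm (rGamma (1 - z)))\<^sup>2 = norm (rGamma z * rGamma (1 - z))"
      by (simp add: norm_mult power2_eq_square)
    also have "\<dots> = norm (sin (of_real pi * z)) / pi"
      by (simp add: rGamma_reflection_complex norm_divide)
    also have "norm (sin (of_real pi * z)) \<le> exp (pi * w * L)"
    proof -
      have "\<i> * (of_real pi * z) = of_real (- pi * w * real_of_int l)"
        by (simp add: z_def algebra_simps)
      hence "sin (of_real pi * z) = (exp (of_real (- pi * w * real_of_int l)) - exp (of_real (pi * w * real_of_int l))) / (2 * \<i>)"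
        unfolding sin_exp_eq by simp
      hence "norm (sin (of_real pi * z)) \<le> (exp (- pi * w * real_of_int l) + exp (pi * w * real_of_int l)) / 2"
        using norm_triangle_ineq4[of "exp (of_real (- pi * w * real_of_int l)) :: complex" "exp (of_real (pi * w * real_of_int l))"]
        by (simp add: norm_divide norm_mult)
      moreover have "exp (- pi * w * real_of_int l) \<le> exp (pi * w * L)" "exp (pi * w * real_of_int l) \<le> exp (pi * w * L)"
      proof -
        have "\<bar>pi * w * real_of_int l\<bar> = pi * w * L" using w by (simp add: abs_mult L_def)
        hence "- (pi * w * real_of_int l) \<le> pi * w * L" "pi * w * real_of_int l \<le> pi * w * L" by linarith+
        thus "exp (- pi * w * real_of_int l) \<le> exp (pi * w * L)" "exp (pi * w * real_of_int l) \<le> exp (pi * w * L)"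
          by (simp_all only: exp_le_cancel_iff mult_minus_left)
      qed
      moreover have "(u + v) / 2 \<le> t" if "u \<le> t" "v \<le> t" for u v t :: real
        using that by simp
      ultimately show ?thesis by (meson order.trans)
    qed
    finally have "(w * L) * (norm (rGamma (1 - z)))\<^sup>2 \<le> exp (pi * w * L) / pi"
      unfolding nz by (simp add: divide_right_mono)
    hence G: "(norm (rGamma (1 - z)))\<^sup>2 \<le> exp (pi * w * L) / (pi * w * L)"
      using w L by (simp add: field_simps)
    have "?x\<^sup>2 = (norm (rGamma (1 - z)))\<^sup>2 * ((1 + L)\<^sup>2 * exp (- (pi * w * L)))"
    proof -
      have "(exp (- (pi * w / 2) * L))\<^sup>2 = exp (- (pi * w * L))"
        by (simp add: power2_eq_square mult_exp_exp)
      thus ?thesis unfolding z_def[symmetric] L_def[symmetric] power_mult_distrib by simp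
    qed
    also have "\<dots> \<le> exp (pi * w * L) / (pi * w * L) * ((1 + L)\<^sup>2 * exp (- (pi * w * L)))"
      using G by (intro mult_right_mono) auto
    also have "\<dots> = (1 + L)\<^sup>2 / (pi * w * L)" by (simp add: exp_minus)
    also have "\<dots> \<le> (2 * L)\<^sup>2 / (pi * w * L)"
      using L w by (intro divide_right_mono power_mono) auto
    also have "\<dots> = 4 / (pi * w) * L" using L w by (simp add: power2_eq_square)
    also have "\<dots> \<le> C\<^sup>2 * L" unfolding C(2) using L by (intro mult_right_mono) auto
    also have "L \<le> (1 + (real_of_int l)\<^sup>2) powr (1/2)"
    proof -
      have "L = sqrt ((real_of_int l)\<^sup>2)" by (simp add: L_def)
      also have "\<dots> \<le> sqrt (1 + (real_of_int l)\<^sup>2)" by (rule real_sqrt_le_mono) simp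
      finally show ?thesis by (simp add: powr_half_sqrt)
    qed
    also have "C\<^sup>2 * (1 + (real_of_int l)\<^sup>2) powr (1/2) = ?y\<^sup>2"
    proof -
      have "(1 + (real_of_int l)\<^sup>2) powr (1/2) = ((1 + (real_of_int l)\<^sup>2) powr (1/4))\<^sup>2"
        unfolding power2_eq_square powr_add[symmetric] by simp
      thus ?thesis by (simp add: power_mult_distrib)
    qed
    finally have "?x\<^sup>2 \<le> ?y\<^sup>2" by (simp add: mult_left_mono)
    thus ?thesis by (rule power2_le_imp_le) (use C in auto)
  qed
  thus thesis by (intro that[of C]) (use C in auto)
qed

text \<open>Translates the assumption on the Fourier coefficients into absolute summability of the
  weighted kernel. The decay \<open>exp (- pi * om T * \<bar>n\<bar>)\<close> of the row factors is
  shared equally between row and column index.\<close>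

lemma summable_qcoef:
  assumes T: "T > 0"
    and p_sum: "(\<lambda>l::int. norm (ptilde p T l) * (1 + (real_of_int l)\<^sup>2) powr (1/4)) summable_on UNIV"
  shows "(\<lambda>(n, m). norm (qcoef p T (n - m)) * (exp (- (pi * om T / 2) * \<bar>real_of_int n\<bar>)
      * exp (- (pi * om T / 2) * \<bar>real_of_int m\<bar>))) summable_on UNIV \<times> UNIV"
proof (rule summable_on_weighted_toeplitz)
  have w: "om T > 0" using T by (simp add: om_def)
  thus "pi * om T / 2 > 0" by simp
  obtain C where C: "C \<ge> 0" "\<And>l::int. norm (rGamma (1 - \<i> * of_real (om T) * of_int l))
      * ((1 + \<bar>real_of_int l\<bar>) * exp (- (pi * om T / 2) * \<bar>real_of_int l\<bar>)) \<le> C * (1 + (real_of_int l)\<^sup>2) powr (1/4)"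
    by (rule rGamma_bound[OF w]) blast
  show "(\<lambda>l. norm (qcoef p T l) * ((1 + \<bar>real_of_int l\<bar>) * exp (- (pi * om T / 2) * \<bar>real_of_int l\<bar>))) summable_on UNIV"
  proof (rule summable_on_comparison_test)
    show "(\<lambda>l. C * (norm (ptilde p T l) * (1 + (real_of_int l)\<^sup>2) powr (1/4))) summable_on UNIV"
      by (intro summable_on_cmult_right p_sum)
    show "norm (qcoef p T l) * ((1 + \<bar>real_of_int l\<bar>) * exp (- (pi * om T / 2) * \<bar>real_of_int l\<bar>))
        \<le> C * (norm (ptilde p T l) * (1 + (real_of_int l)\<^sup>2) powr (1/4))" for l
      using mult_left_mono[OF C(2)[of l], of "norm (ptilde p T l)"] by (simp add: qcoef_def norm_mult mult_ac)
  qed auto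
qed auto

section \<open>Convergence of the Fredholm expansion\<close>

text \<open>Isolates what the convergence argument uses of \<open>p\<close>: double summability of
  the entries after the weighted conjugation.\<close>

locale toeplitz_family =
  fixes T :: real and q :: "int \<Rightarrow> complex" and lam :: complex
  assumes T: "T > 0" and lam: "lam \<noteq> 0"
    and sum: "(\<lambda>(n, m). norm (q (n - m)) * (exp (- (pi * om T / 2) * \<bar>real_of_int n\<bar>)
      * exp (- (pi * om T / 2) * \<bar>real_of_int m\<bar>))) summable_on UNIV \<times> UNIV"
begin

text \<open>The coefficients are an argument so that the truncated and the full sequence fall under
  the same bounds.\<close>

definition fd :: "(int \<Rightarrow> complex) \<Rightarrow> complex \<Rightarrow> complex" where
  "fd Q s = fredholm_det_I_minus (kern (om T) Q lam s)"

lemma om_pos: "om T > 0" using T by (simp add: om_def)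

text \<open>The majorant \<open>b\<close> depends neither on \<open>s\<close> nor on the choice of
  \<open>Q\<close> below \<open>q\<close>, which gives uniformity in the truncation. The only
  singular factor is that of row 0, and it enters linearly.\<close>

lemma minor_domination:
  obtains b where "b summable_on {S. finite S}" "\<And>S. b S \<ge> 0"
    "\<And>Q s S. (\<And>l. norm (Q l) \<le> norm (q l)) \<Longrightarrow> finite S \<Longrightarrow> \<bar>Re s\<bar> \<le> 3 * om T / 4 \<Longrightarrow>
      norm (pminor (kern (om T) Q lam s) S) \<le> (1 + norm (sech_shift (om T) 0 s)) * b S"
proof -
  obtain C where C: "C \<ge> 1" "\<And>n s. n \<noteq> 0 \<Longrightarrow> \<bar>Re s\<bar> \<le> 3 * om T / 4 \<Longrightarrow>
      norm (sech_shift (om T) n s) \<le> C * exp (- pi * om T * \<bar>real_of_int n\<bar>)"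
    by (rule sech_shift_bound[OF om_pos]) blast
  define E where "E = (\<lambda>n::int. exp (- (pi * om T / 2) * \<bar>real_of_int n\<bar>))"
  have Epos: "E n > 0" for n by (simp add: E_def)
  have EE: "E n * E n = exp (- pi * om T * \<bar>real_of_int n\<bar>)" for n
    by (simp add: E_def mult_exp_exp)
  define \<rho> where "\<rho> = (\<lambda>n. infsum (\<lambda>m. norm (q (n - m)) * (E n * E m)) UNIV)"
  have sum': "(\<lambda>(n, m). norm (q (n - m)) * (E n * E m)) summable_on UNIV \<times> UNIV"
    using sum by (simp add: E_def)
  have row: "(\<lambda>m. norm (q (n - m)) * (E n * E m)) summable_on UNIV" for n
    using summable_on_SigmaD1[OF sum', of n] by simp
  have \<rho>sum: "\<rho> summable_on UNIV"
    using summable_on_SigmaD[OF sum'] row by (simp add: \<rho>_def)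
  have \<rho>pos: "\<rho> n \<ge> 0" for n
    unfolding \<rho>_def using Epos by (intro infsum_nonneg mult_nonneg_nonneg) (auto intro: less_imp_le)
  define \<beta> where "\<beta> = (\<lambda>n. C / norm lam * \<rho> n)"
  have \<beta>pos: "\<beta> n \<ge> 0" for n using C \<rho>pos by (simp add: \<beta>_def)
  have \<beta>sum: "\<beta> summable_on UNIV" unfolding \<beta>_def by (intro summable_on_cmult_right \<rho>sum)
  show thesis
  proof
    show "(\<lambda>S. \<Prod>n\<in>S. \<beta> n) summable_on {S. finite S}"
      using \<beta>sum \<beta>pos by (rule summable_on_prod_finite_sets)
    show "(\<Prod>n\<in>S. \<beta> n) \<ge> 0" for S using \<beta>pos by (intro prod_nonneg) auto
    fix Q :: "int \<Rightarrow> complex" and s and S :: "int set"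
    assume Q: "\<And>l. norm (Q l) \<le> norm (q l)" and S: "finite S" and s: "\<bar>Re s\<bar> \<le> 3 * om T / 4"
    define t where "t = 1 + norm (sech_shift (om T) 0 s)"
    \<comment> \<open>Conjugation with \<open>1 / E n\<close> hands half of the decay of the row
      factors over to the columns, where it makes the row sums of \<open>q\<close> converge.\<close>
    define d where "d = (\<lambda>n. of_real (1 / E n) :: complex)"
    have d: "d n \<noteq> 0" for n using Epos[of n] by (simp add: d_def)
    have rowsum: "(\<Sum>m\<in>S. norm (d n * kern (om T) Q lam s n m / d m)) \<le> (if n = 0 then t else 1) * \<beta> n" for n
    proof -
      define A where "A = norm (sech_shift (om T) n s) / (norm lam * (E n * E n))"
      have A: "A \<ge> 0" using Epos[of n] by (simp add: A_def)
      have "norm (d n * kern (om T) Q lam s n m / d m) = A * (norm (Q (n - m)) * (E n * E m))" for m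
        using Epos[of n] Epos[of m] by (simp add: d_def kern_def A_def norm_mult norm_divide mult_ac)
      hence "(\<Sum>m\<in>S. norm (d n * kern (om T) Q lam s n m / d m)) = A * (\<Sum>m\<in>S. norm (Q (n - m)) * (E n * E m))"
        by (simp add: sum_distrib_left)
      also have "\<dots> \<le> A * (\<Sum>m\<in>S. norm (q (n - m)) * (E n * E m))"
        using A Q Epos by (intro mult_left_mono sum_mono mult_right_mono) (auto intro!: mult_nonneg_nonneg less_imp_le)
      also have "(\<Sum>m\<in>S. norm (q (n - m)) * (E n * E m)) \<le> \<rho> n"
        unfolding \<rho>_def using row S
        by (intro finite_sum_le_infsum) (auto simp: E_def)
      also have "A * \<rho> n \<le> ((if n = 0 then t else 1) * C / norm lam) * \<rho> n"
      proof (intro mult_right_mono \<rho>pos)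
        have "norm (sech_shift (om T) n s) / (E n * E n) \<le> (if n = 0 then t else 1) * C"
        proof (cases "n = 0")
          case True
          have "norm (sech_shift (om T) 0 s) * 1 \<le> t * C" using C by (intro mult_mono) (auto simp: t_def)
          thus ?thesis using True by (simp add: E_def)
        next
          case False
          thus ?thesis using C(2)[OF False s, folded EE] Epos[of n] by (simp add: divide_le_eq)
        qed
        from divide_right_mono[OF this, of "norm lam"] show "A \<le> (if n = 0 then t else 1) * C / norm lam"
          by (simp add: A_def mult.commute)
      qed
      finally show ?thesis using A by (simp add: \<beta>_def mult_left_mono)
    qed
    have "pminor (kern (om T) Q lam s) S = pminor (\<lambda>n m. d n * kern (om T) Q lam s n m / d m) S"
      using d by (rule pminor_diagonal_conjugation[symmetric])
    also have "norm \<dots> \<le> (\<Prod>n\<in>S. \<Sum>m\<in>S. norm (d n * kern (om T) Q lam s n m / d m))"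
      using S by (rule norm_pminor_le)
    also have "\<dots> \<le> (\<Prod>n\<in>S. (if n = 0 then t else 1) * \<beta> n)"
      using rowsum by (intro prod_mono) (auto intro!: sum_nonneg)
    \<comment> \<open>Row 0 occurs at most once in a minor, so \<open>t\<close> appears to the first
      power; this is why the poles are at most simple.\<close>
    also have "\<dots> = (if 0 \<in> S then t else 1) * (\<Prod>n\<in>S. \<beta> n)"
      using S by (simp add: prod.distrib prod.delta)
    also have "\<dots> \<le> t * (\<Prod>n\<in>S. \<beta> n)"
      using \<beta>pos by (intro mult_right_mono prod_nonneg) (auto simp: t_def)
    finally show "norm (pminor (kern (om T) Q lam s) S) \<le> (1 + norm (sech_shift (om T) 0 s)) * (\<Prod>n\<in>S. \<beta> n)"
      by (simp add: t_def)
  qed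
qed

lemma fd_periodic: "fd Q (s + of_real (om T) * of_int n) = fd Q s"
  using int_periodic[of UNIV "fd Q" "of_real (om T)" s n] fredholm_kern_shift by (simp add: fd_def)

text \<open>The tail of the expansion is small uniformly in \<open>N\<close> and \<open>s\<close> by
  the majorant, and each finite partial sum is unaffected by truncation once \<open>N\<close> is
  large.\<close>

lemma fd_uniform_limit_on_strip:
  assumes X: "\<And>s. s \<in> X \<Longrightarrow> \<bar>Re s\<bar> \<le> 3 * om T / 4" "\<And>s. s \<in> X \<Longrightarrow> norm (sech_shift (om T) 0 s) \<le> M"
  shows "uniform_limit X (\<lambda>N. fd (trunc N q)) (fd q) sequentially"
proof (cases "X = {}")
  case False
  obtain b where b: "b summable_on {S. finite S}" "\<And>S. b S \<ge> 0"
    "\<And>Q s S. (\<And>l. norm (Q l) \<le> norm (q l)) \<Longrightarrow> finite S \<Longrightarrow> \<bar>Re s\<bar> \<le> 3 * om T / 4 \<Longrightarrow>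
      norm (pminor (kern (om T) Q lam s) S) \<le> (1 + norm (sech_shift (om T) 0 s)) * b S"
    by (rule minor_domination) blast
  have bd: "norm ((-1) ^ card S * pminor (kern (om T) Q lam s) S) \<le> (1 + M) * b S"
    if "\<And>l. norm (Q l) \<le> norm (q l)" "S \<in> {S. finite S}" "s \<in> X" for Q s S
  proof -
    have "norm (pminor (kern (om T) Q lam s) S) \<le> (1 + norm (sech_shift (om T) 0 s)) * b S"
      using b(3)[OF that(1) _ X(1)[OF that(3)], of S] that(2) by simp
    also have "\<dots> \<le> (1 + M) * b S" using X(2)[OF that(3)] b(2) by (intro mult_right_mono) auto
    finally show ?thesis by (simp add: norm_mult norm_power)
  qed
  have sb: "(\<lambda>S. (1 + M) * b S) summable_on {S. finite S}" by (intro summable_on_cmult_right b)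
  have summ: "(\<lambda>S. (-1) ^ card S * pminor (kern (om T) Q lam s) S) summable_on {S. finite S}"
    if "\<And>l. norm (Q l) \<le> norm (q l)" "s \<in> X" for Q s
    by (rule abs_summable_summable, rule summable_on_comparison_test[OF sb]) (use bd that in auto)
  \<comment> \<open>The parameter is the pair of \<open>N\<close> and \<open>s\<close>, so that one
    Weierstrass test gives uniformity in both.\<close>
  define f where "f = (\<lambda>S (N, s). (-1) ^ card S * pminor (kern (om T) (trunc N q) lam s) S
      - (-1) ^ card S * pminor (kern (om T) q lam s) S)"
  have fsum: "infsum (\<lambda>S. f S (N, s)) {S. finite S} = fd (trunc N q) s - fd q s" if "s \<in> X" for N s
    unfolding f_def fd_def fredholm_det_I_minus_def prod.case
    using summ[of q, OF _ that] summ[of "trunc N q", OF norm_trunc_le that]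
    unfolding diff_conv_add_uminus by (intro infsumI has_sum_add has_sum_uminusI) auto
  have ul: "uniform_limit (UNIV \<times> X) (\<lambda>\<F> y. \<Sum>S\<in>\<F>. f S y) (\<lambda>y. \<Sum>\<^sub>\<infinity>S\<in>{S. finite S}. f S y)
      (finite_subsets_at_top {S. finite S})"
  proof (rule Weierstrass_m_test_general)
    show "(\<lambda>S. 2 * ((1 + M) * b S)) summable_on {S. finite S}" by (intro summable_on_cmult_right b)
    fix S :: "int set" and y :: "nat \<times> complex"
    assume S: "S \<in> {S. finite S}" and y: "y \<in> UNIV \<times> X"
    obtain N s where ys: "y = (N, s)" "s \<in> X" using y by auto
    have "norm (f S y) \<le> norm ((-1) ^ card S * pminor (kern (om T) (trunc N q) lam s) S)
        + norm ((-1) ^ card S * pminor (kern (om T) q lam s) S)"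
      unfolding f_def ys prod.case by (rule norm_triangle_ineq4)
    also have "\<dots> \<le> (1 + M) * b S + (1 + M) * b S"
      using S ys by (intro add_mono bd norm_trunc_le) auto
    finally show "norm (f S y) \<le> 2 * ((1 + M) * b S)" by (simp only: mult_2)
  qed
  show ?thesis
  proof (rule uniform_limitI)
    fix \<epsilon> :: real assume "\<epsilon> > 0"
    from uniform_limitD[OF ul this] obtain \<F> where F: "finite \<F>" "\<F> \<subseteq> {S. finite S}"
      "\<And>y. y \<in> UNIV \<times> X \<Longrightarrow> dist (\<Sum>S\<in>\<F>. f S y) (\<Sum>\<^sub>\<infinity>S\<in>{S. finite S}. f S y) < \<epsilon>"
      unfolding eventually_finite_subsets_at_top by (metis order_refl)
    \<comment> \<open>The largest index difference occurring in the minors from \<open>\<F>\<close>;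
      from this \<open>N\<close> on, truncation leaves those minors unchanged.\<close>
    define N0 where "N0 = Max ((\<lambda>(n, m). nat \<bar>n - m\<bar>) ` (\<Union>\<F> \<times> \<Union>\<F>))"
    have "finite ((\<lambda>(n, m). nat \<bar>n - m\<bar>) ` (\<Union>\<F> \<times> \<Union>\<F>))" using F by auto
    hence N0: "k \<le> N0" if "k \<in> (\<lambda>(n, m). nat \<bar>n - m\<bar>) ` (\<Union>\<F> \<times> \<Union>\<F>)" for k
      unfolding N0_def using that by (rule Max_ge)
    have "dist (fd (trunc N q) s) (fd q s) < \<epsilon>" if N: "N \<ge> N0" and s: "s \<in> X" for N s
    proof -
      have "f S (N, s) = 0" if S: "S \<in> \<F>" for S
      proof -
        have "pminor (kern (om T) (trunc N q) lam s) S = pminor (kern (om T) q lam s) S"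
        proof (rule pminor_cong)
          fix i j assume "i \<in> S" "j \<in> S"
          hence "nat \<bar>i - j\<bar> \<le> N0" using S by (intro N0) (auto intro!: image_eqI[of _ _ "(i, j)"])
          thus "kern (om T) (trunc N q) lam s i j = kern (om T) q lam s i j"
            using N by (simp add: kern_def trunc_def)
        qed
        thus ?thesis by (simp add: f_def)
      qed
      hence "dist 0 (\<Sum>\<^sub>\<infinity>S\<in>{S. finite S}. f S (N, s)) < \<epsilon>" using F(3)[of "(N, s)"] s by simp
      thus ?thesis unfolding fsum[OF s] by (simp add: dist_norm norm_minus_commute)
    qed
    thus "\<forall>\<^sub>F N in sequentially. \<forall>s\<in>X. dist (fd (trunc N q) s) (fd q s) < \<epsilon>"
      unfolding eventually_sequentially by blast
  qed
qed (simp add: uniform_limit_iff)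

lemma fd_tendsto:
  assumes "s \<notin> Lam T"
  shows "(\<lambda>N. fd (trunc N q) s) \<longlonglongrightarrow> fd q s"
proof -
  obtain n :: int where n: "\<bar>Re (s + of_real (om T) * of_int n)\<bar> \<le> om T / 2"
    using strip_reduction[OF T] by blast
  define t where "t = s + of_real (om T) * of_int n"
  have "uniform_limit {t} (\<lambda>N. fd (trunc N q)) (fd q) sequentially"
    by (rule fd_uniform_limit_on_strip[of _ "norm (sech_shift (om T) 0 t)"]) (use n om_pos in \<open>auto simp: t_def\<close>)
  hence "(\<lambda>N. fd (trunc N q) t) \<longlonglongrightarrow> fd q t" by (rule tendsto_uniform_limitI) simp
  thus ?thesis by (simp add: t_def fd_periodic)
qed

text \<open>Adding \<open>\<i>\<close> preserves the norm and the distances to \<open>Lam T\<close>,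
  so it suffices to bound the function on a compact part of one rectangle.\<close>

lemma sech_shift0_bounded:
  assumes \<delta>: "\<delta> > 0"
  obtains M where "\<And>t. \<bar>Re t\<bar> \<le> om T / 2 \<Longrightarrow> (\<And>a. a \<in> Lam T \<Longrightarrow> \<delta> \<le> dist t a) \<Longrightarrow> norm (sech_shift (om T) 0 t) \<le> M"
proof -
  define K where "K = cbox (Complex (- om T / 2) 0) (Complex (om T / 2) 1) \<inter> (\<Inter>a\<in>Lam T. {t. \<delta> \<le> dist t a})"
  have KL: "K \<subseteq> - Lam T" using \<delta> by (force simp: K_def)
  have "compact K" unfolding K_def
    by (intro compact_Int_closed compact_cbox closed_INT ballI closed_Collect_le continuous_intros)
  moreover have "continuous_on K (sech_shift (om T) 0)"
    using holomorphic_on_imp_continuous_on[OF holomorphic_sech_shift] KL by (rule continuous_on_subset)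
  ultimately have "bounded (sech_shift (om T) 0 ` K)" by (intro compact_imp_bounded compact_continuous_image)
  then obtain M where M: "\<And>t. t \<in> K \<Longrightarrow> norm (sech_shift (om T) 0 t) \<le> M" unfolding bounded_iff by blast
  show thesis
  proof
    fix t assume t: "\<bar>Re t\<bar> \<le> om T / 2" "\<And>a. a \<in> Lam T \<Longrightarrow> \<delta> \<le> dist t a"
    define m where "m = - floor (Im t)"
    define u where "u = t + \<i> * of_int m"
    have "Im u \<ge> 0" "Im u \<le> 1" by (simp_all add: u_def m_def) linarith+
    moreover have "Re u = Re t" by (simp add: u_def)
    moreover have "\<delta> \<le> dist u a" if "a \<in> Lam T" for a
    proof -
      have "a + of_real (om T) * of_int 0 + \<i> * of_int (- m) \<in> Lam T" using that by (rule Lam_add)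
      from t(2)[OF this] show ?thesis by (simp add: u_def dist_norm algebra_simps)
    qed
    ultimately have "u \<in> K" using t(1) by (auto simp: K_def in_cbox_complex_iff)
    moreover have "norm (sech_shift (om T) 0 u) = norm (sech_shift (om T) 0 t)" unfolding u_def
      using int_periodic[of UNIV "\<lambda>s. norm (sech_shift (om T) 0 s)" \<i> t m] by (simp add: sech_shift_add_i)
    ultimately show "norm (sech_shift (om T) 0 t) \<le> M" using M by metis
  qed
qed

text \<open>Translation by multiples of \<open>om T\<close> preserves both the determinants and the
  distance to \<open>Lam T\<close>, which reduces the claim to the strip.\<close>

lemma fd_uniform_limit:
  assumes \<delta>: "\<delta> > 0"
  shows "uniform_limit {s. infdist s (Lam T) > \<delta>} (\<lambda>N. fd (trunc N q)) (fd q) sequentially"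
proof -
  define X where "X = {t. \<bar>Re t\<bar> \<le> om T / 2 \<and> (\<forall>a\<in>Lam T. \<delta> \<le> dist t a)}"
  obtain M where M: "\<And>t. \<bar>Re t\<bar> \<le> om T / 2 \<Longrightarrow> (\<And>a. a \<in> Lam T \<Longrightarrow> \<delta> \<le> dist t a) \<Longrightarrow> norm (sech_shift (om T) 0 t) \<le> M"
    by (rule sech_shift0_bounded[OF \<delta>]) blast
  have ul: "uniform_limit X (\<lambda>N. fd (trunc N q)) (fd q) sequentially"
    by (rule fd_uniform_limit_on_strip[of _ M]) (use M om_pos in \<open>auto simp: X_def\<close>)
  show ?thesis
  proof (rule uniform_limitI)
    fix \<epsilon> :: real assume "\<epsilon> > 0"
    from uniform_limitD[OF ul this]
    show "\<forall>\<^sub>F N in sequentially. \<forall>s\<in>{s. infdist s (Lam T) > \<delta>}. dist (fd (trunc N q) s) (fd q s) < \<epsilon>"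
    proof (rule eventually_mono, intro ballI)
      fix N s assume N: "\<forall>s\<in>X. dist (fd (trunc N q) s) (fd q s) < \<epsilon>" and s: "s \<in> {s. infdist s (Lam T) > \<delta>}"
      obtain n :: int where n: "\<bar>Re (s + of_real (om T) * of_int n)\<bar> \<le> om T / 2"
        using strip_reduction[OF T] by blast
      define t where "t = s + of_real (om T) * of_int n"
      have "\<delta> \<le> dist t a" if "a \<in> Lam T" for a
      proof -
        have "a + of_real (om T) * of_int (- n) + \<i> * of_int 0 \<in> Lam T" using that by (rule Lam_add)
        from infdist_le[OF this, of s] s show ?thesis by (simp add: t_def dist_norm algebra_simps)
      qed
      hence "t \<in> X" using n by (simp add: X_def t_def)
      with N have "dist (fd (trunc N q) t) (fd q t) < \<epsilon>" by blast
      thus "dist (fd (trunc N q) s) (fd q s) < \<epsilon>" by (simp add: t_def fd_periodic)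
    qed
  qed
qed

text \<open>The finite partial sums of the expansion are holomorphic and converge uniformly on small
  discs in a strip; periodicity carries the result to the whole complement of
  \<open>Lam T\<close>.\<close>

lemma fd_holomorphic: "fd q holomorphic_on - Lam T"
proof -
  obtain b where b: "b summable_on {S. finite S}" "\<And>S. b S \<ge> 0"
    "\<And>Q s S. (\<And>l. norm (Q l) \<le> norm (q l)) \<Longrightarrow> finite S \<Longrightarrow> \<bar>Re s\<bar> \<le> 3 * om T / 4 \<Longrightarrow>
      norm (pminor (kern (om T) Q lam s) S) \<le> (1 + norm (sech_shift (om T) 0 s)) * b S"
    by (rule minor_domination) blast
  \<comment> \<open>The strip is wider than a period, so the closed period strip, apart from
    \<open>Lam T\<close>, lies in this open set.\<close>
  define G where "G = {s. \<bar>Re s\<bar> < 3 * om T / 4} \<inter> - Lam T"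
  have op: "open G" unfolding G_def
    by (intro open_Int open_compl_Lam T open_Collect_less continuous_intros)
  have loc: "\<exists>D. (fd q has_field_derivative D) (at z)" if z: "z \<in> G" for z
  proof -
    obtain d where d: "d > 0" "cball z d \<subseteq> G" using op z open_contains_cball by blast
    have "continuous_on (cball z d) (sech_shift (om T) 0)"
      using holomorphic_on_imp_continuous_on[OF holomorphic_sech_shift] d by (rule_tac continuous_on_subset) (auto simp: G_def)
    hence "bounded (sech_shift (om T) 0 ` cball z d)"
      by (intro compact_imp_bounded compact_continuous_image) auto
    then obtain M where M: "\<And>t. t \<in> cball z d \<Longrightarrow> norm (sech_shift (om T) 0 t) \<le> M" unfolding bounded_iff by blast
    have "uniform_limit (cball z d) (\<lambda>\<F> s. \<Sum>S\<in>\<F>. (-1) ^ card S * pminor (kern (om T) q lam s) S)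
        (\<lambda>s. \<Sum>\<^sub>\<infinity>S\<in>{S. finite S}. (-1) ^ card S * pminor (kern (om T) q lam s) S) (finite_subsets_at_top {S. finite S})"
    proof (rule Weierstrass_m_test_general)
      show "(\<lambda>S. (1 + M) * b S) summable_on {S. finite S}" by (intro summable_on_cmult_right b)
      fix S :: "int set" and s assume S: "S \<in> {S. finite S}" and s: "s \<in> cball z d"
      have "s \<in> G" using s d by blast
      hence "norm (pminor (kern (om T) q lam s) S) \<le> (1 + norm (sech_shift (om T) 0 s)) * b S"
        using S by (intro b(3)) (auto simp: G_def)
      also have "\<dots> \<le> (1 + M) * b S" using M[OF s] b(2) by (intro mult_right_mono) auto
      finally show "norm ((-1) ^ card S * pminor (kern (om T) q lam s) S) \<le> (1 + M) * b S"
        by (simp add: norm_mult norm_power)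
    qed
    hence ul: "uniform_limit (cball z d) (\<lambda>\<F> s. \<Sum>S\<in>\<F>. (-1) ^ card S * pminor (kern (om T) q lam s) S)
        (fd q) (finite_subsets_at_top {S. finite S})"
      by (simp add: fd_def[abs_def] fredholm_det_I_minus_def)
    have ps: "(\<lambda>s. \<Sum>S\<in>\<F>. (-1) ^ card S * pminor (kern (om T) q lam s) S) holomorphic_on - Lam T" for \<F>
      unfolding pminor_def kern_def by (intro holomorphic_intros lam)
    have "fd q holomorphic_on ball z d"
    proof (rule holomorphic_uniform_limit[OF _ ul])
      show "\<forall>\<^sub>F \<F> in finite_subsets_at_top {S. finite S}.
          continuous_on (cball z d) (\<lambda>s. \<Sum>S\<in>\<F>. (-1) ^ card S * pminor (kern (om T) q lam s) S) \<and>
          (\<lambda>s. \<Sum>S\<in>\<F>. (-1) ^ card S * pminor (kern (om T) q lam s) S) holomorphic_on ball z d"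
      proof (intro always_eventually allI conjI)
        have sub: "cball z d \<subseteq> - Lam T" "ball z d \<subseteq> - Lam T" using d ball_subset_cball[of z d] unfolding G_def by blast+
        show "continuous_on (cball z d) (\<lambda>s. \<Sum>S\<in>\<F>. (-1) ^ card S * pminor (kern (om T) q lam s) S)" for \<F>
          using holomorphic_on_imp_continuous_on[OF ps] sub(1) by (rule continuous_on_subset)
        show "(\<lambda>s. \<Sum>S\<in>\<F>. (-1) ^ card S * pminor (kern (om T) q lam s) S) holomorphic_on ball z d" for \<F>
          using ps sub(2) by (rule holomorphic_on_subset)
      qed
    qed (auto simp: finite_subsets_at_top_neq_bot)
    thus ?thesis using d holomorphic_derivI[of "fd q" "ball z d" z] by auto
  qed
  show ?thesis
    unfolding holomorphic_on_open[OF open_compl_Lam[OF T]]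
  proof
    fix z assume z: "z \<in> - Lam T"
    obtain n :: int where n: "\<bar>Re (z + of_real (om T) * of_int n)\<bar> \<le> om T / 2"
      using strip_reduction[OF T] by blast
    have "z + of_real (om T) * of_int n \<in> G"
      using n om_pos z Lam_add_iff[of z T n 0] by (auto simp: G_def)
    from loc[OF this] obtain D where "(fd q has_field_derivative D) (at (z + of_real (om T) * of_int n))" by blast
    hence "((\<lambda>s. fd q (s + of_real (om T) * of_int n)) has_field_derivative D) (at z)"
      by (simp add: DERIV_shift)
    thus "\<exists>D. (fd q has_field_derivative D) (at z)" unfolding fd_periodic by blast
  qed
qed

text \<open>The majorant is linear in the modulus of the row 0 factor, whose denominator has a
  simple zero at \<open>\<i> / 2\<close> with derivative \<open>\<i> * pi\<close>.\<close>

lemma fd_near_pole: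
  obtains e B where "e > 0" "\<And>s. s \<in> ball (\<i> / 2) e - {\<i> / 2} \<Longrightarrow> norm ((s - \<i> / 2) * fd q s) \<le> B"
proof -
  obtain b where b: "b summable_on {S. finite S}" "\<And>S. b S \<ge> 0"
    "\<And>Q s S. (\<And>l. norm (Q l) \<le> norm (q l)) \<Longrightarrow> finite S \<Longrightarrow> \<bar>Re s\<bar> \<le> 3 * om T / 4 \<Longrightarrow>
      norm (pminor (kern (om T) Q lam s) S) \<le> (1 + norm (sech_shift (om T) 0 s)) * b S"
    by (rule minor_domination) blast
  define h where "h = (\<lambda>s. cos (\<i> * of_real pi * s))"
  have h0: "h (\<i> / 2) = 0"
  proof -
    have "\<i> * of_real pi * (\<i> / 2) = - of_real (pi / 2)" by (simp add: complex_eq_iff)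
    hence "h (\<i> / 2) = cos (- of_real (pi / 2))" unfolding h_def by (rule arg_cong)
    thus ?thesis unfolding cos_minus cos_of_real by simp
  qed
  have "(h has_field_derivative (- sin (\<i> * of_real pi * (\<i> / 2)) * (\<i> * of_real pi))) (at (\<i> / 2))"
    unfolding h_def by (auto intro!: derivative_eq_intros)
  moreover have "- sin (\<i> * of_real pi * (\<i> / 2)) = 1"
  proof -
    have "\<i> * of_real pi * (\<i> / 2) = - of_real (pi / 2)" by (simp add: complex_eq_iff)
    hence "sin (\<i> * of_real pi * (\<i> / 2)) = sin (- of_real (pi / 2) :: complex)" by (rule arg_cong)
    thus ?thesis unfolding sin_minus sin_of_real by simp
  qed
  ultimately have "(h has_field_derivative (\<i> * of_real pi)) (at (\<i> / 2))"
    by (simp only: mult_1_left)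
  hence "((\<lambda>s. h s / (s - \<i> / 2)) \<longlongrightarrow> \<i> * of_real pi) (at (\<i> / 2))"
    unfolding has_field_derivative_iff h0 by simp
  hence "((\<lambda>s. of_real pi * inverse (h s / (s - \<i> / 2))) \<longlongrightarrow> of_real pi * inverse (\<i> * of_real pi)) (at (\<i> / 2))"
    by (intro tendsto_intros) auto
  hence "((\<lambda>s. (s - \<i> / 2) * sech_shift (om T) 0 s) \<longlongrightarrow> of_real pi * inverse (\<i> * of_real pi)) (at (\<i> / 2))"
    by (simp add: sech_shift_def h_def mult_ac)
  from tendstoD[OF this zero_less_one] obtain e1 where e1: "e1 > 0"
    "\<And>s. s \<noteq> \<i> / 2 \<Longrightarrow> dist s (\<i> / 2) < e1 \<Longrightarrow>
      dist ((s - \<i> / 2) * sech_shift (om T) 0 s) (of_real pi * inverse (\<i> * of_real pi)) < 1"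
    unfolding eventually_at by blast
  define M where "M = 1 + norm (of_real pi * inverse (\<i> * of_real pi) :: complex)"
  have M: "norm ((s - \<i> / 2) * sech_shift (om T) 0 s) \<le> M" if "s \<noteq> \<i> / 2" "dist s (\<i> / 2) < e1" for s
    using e1(2)[OF that] norm_triangle_ineq2[of "(s - \<i> / 2) * sech_shift (om T) 0 s" "of_real pi * inverse (\<i> * of_real pi)"]
    unfolding M_def dist_norm by linarith
  \<comment> \<open>The radius \<open>om T / 2\<close> keeps \<open>s\<close> in the strip of
    \<open>minor_domination\<close>, and the radius 1 bounds the factor
    \<open>s - \<i> / 2\<close>.\<close>
  define e where "e = min e1 (min 1 (om T / 2))"
  have e: "e > 0" using e1 om_pos by (simp add: e_def)
  show thesis
  proof (rule that[OF e])
    fix s assume s: "s \<in> ball (\<i> / 2) e - {\<i> / 2}"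
    have ds: "dist s (\<i> / 2) < e" "s \<noteq> \<i> / 2" using s by (auto simp: dist_commute)
    have "\<bar>Re (s - \<i> / 2)\<bar> < e" using abs_Re_le_cmod[of "s - \<i> / 2"] ds by (simp add: dist_norm)
    hence Re: "\<bar>Re s\<bar> \<le> 3 * om T / 4" using om_pos by (simp add: e_def)
    define t where "t = 1 + norm (sech_shift (om T) 0 s)"
    have "norm (fd q s) \<le> (\<Sum>\<^sub>\<infinity>S\<in>{S. finite S}. t * b S)"
      unfolding fd_def fredholm_det_I_minus_def
    proof (rule norm_infsum_le)
      show bdd: "norm ((-1) ^ card S * pminor (kern (om T) q lam s) S) \<le> t * b S" if "S \<in> {S. finite S}" for S
        using b(3)[of q S s] that Re by (simp add: t_def norm_mult norm_power)
      have sb: "(\<lambda>S. t * b S) summable_on {S. finite S}" by (intro summable_on_cmult_right b)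
      thus "((\<lambda>S. t * b S) has_sum (\<Sum>\<^sub>\<infinity>S\<in>{S. finite S}. t * b S)) {S. finite S}" by simp
      have "(\<lambda>S. (-1) ^ card S * pminor (kern (om T) q lam s) S) summable_on {S. finite S}"
        by (rule abs_summable_summable, rule summable_on_comparison_test[OF sb]) (use bdd in auto)
      thus "((\<lambda>S. (-1) ^ card S * pminor (kern (om T) q lam s) S) has_sum
          (\<Sum>\<^sub>\<infinity>S\<in>{S. finite S}. (-1) ^ card S * pminor (kern (om T) q lam s) S)) {S. finite S}" by simp
    qed
    also have "\<dots> = t * infsum b {S. finite S}" by (rule infsum_cmult_right) (rule b)
    finally have "norm ((s - \<i> / 2) * fd q s) \<le> norm (s - \<i> / 2) * (t * infsum b {S. finite S})"
      unfolding norm_mult by (intro mult_left_mono) auto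
    also have "\<dots> = (norm (s - \<i> / 2) + norm ((s - \<i> / 2) * sech_shift (om T) 0 s)) * infsum b {S. finite S}"
      unfolding t_def norm_mult by (simp only: distrib_left distrib_right mult.assoc mult_1_left mult_1_right)
    also have "\<dots> \<le> (1 + M) * infsum b {S. finite S}"
    proof (intro mult_right_mono add_mono)
      show "norm (s - \<i> / 2) \<le> 1" using ds by (simp add: e_def dist_norm)
      show "norm ((s - \<i> / 2) * sech_shift (om T) 0 s) \<le> M" using M[of s] ds by (simp add: e_def)
      show "infsum b {S. finite S} \<ge> 0" using b(2) by (intro infsum_nonneg) auto
    qed
    finally show "norm ((s - \<i> / 2) * fd q s) \<le> (1 + M) * infsum b {S. finite S}" .
  qed
qed

end

section \<open>Identification of \<open>Delta\<close> and assembly of the theorem\<close>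

lemma Delta_eq_fredholm:
  assumes T: "T > 0" and lam: "lam \<noteq> 0" and s: "s \<notin> Lam T"
    and p_sum: "(\<lambda>l::int. norm (ptilde p T l) * (1 + (real_of_int l)\<^sup>2) powr (1/4)) summable_on UNIV"
  shows "(\<lambda>N. DeltaN p T N lam s) \<longlonglongrightarrow> fredholm_det_I_minus (kern (om T) (qcoef p T) lam s)"
    and "Delta p T lam s = fredholm_det_I_minus (kern (om T) (qcoef p T) lam s)"
proof -
  interpret toeplitz_family T "qcoef p T" lam
    by unfold_locales (use T lam summable_qcoef[OF T p_sum] in auto)
  show lim: "(\<lambda>N. DeltaN p T N lam s) \<longlonglongrightarrow> fredholm_det_I_minus (kern (om T) (qcoef p T) lam s)"
    using fd_tendsto[OF s] by (simp add: fd_def DeltaN_eq[OF s])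
  thus "Delta p T lam s = fredholm_det_I_minus (kern (om T) (qcoef p T) lam s)"
    unfolding Delta_def by (rule limI)
qed

theorem theorem4p1:
  fixes p :: "real \<Rightarrow> real" and T :: real and lam :: complex
  assumes T_pos: "T > 0"
    and p_per: "\<forall>x. p (x + T) = p x"
    and p_int: "p absolutely_integrable_on {0..T}"
    and p_sum: "(\<lambda>l::int. norm (ptilde p T l) * (1 + (real_of_int l)\<^sup>2) powr (1/4)) summable_on UNIV"
    and lam_nz: "lam \<noteq> 0"
  shows
    \<comment> \<open>(i)\<close>
    "(\<forall>s. s \<notin> Lam T \<longrightarrow> (\<lambda>N. DeltaN p T N lam s) \<longlonglongrightarrow> Delta p T lam s)
     \<and> (\<forall>\<delta>>0. uniform_limit {s. infdist s (Lam T) > \<delta>}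
                              (\<lambda>N s. DeltaN p T N lam s) (Delta p T lam) sequentially)
     \<and> (\<forall>s. s \<notin> Lam T \<and> \<bar>Im s\<bar> < 1 \<longrightarrow>
            Delta p T lam s = fredholm_det_I_minus (\<lambda>n m. Hmat p T s n m / lam))
    \<comment> \<open>(ii)\<close>
     \<and> (\<forall>s. s \<notin> Lam T \<longrightarrow>
            Delta p T lam (- s) = Delta p T lam s
          \<and> Delta p T lam (s + 2 * \<i>) = Delta p T lam s
          \<and> Delta p T lam (s + of_real (om T)) = Delta p T lam s
          \<and> cnj (Delta p T lam s) = Delta p T (cnj lam) (cnj s)
          \<and> Delta p T lam (s + \<i>) = Delta p T (- lam) s)
     \<and> ((\<exists>c. \<forall>s. s \<notin> Lam T \<longrightarrow> Delta p T lam s = c)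
        \<or> (Delta p T lam holomorphic_on (- Lam T)
           \<and> (\<forall>z\<in>Lam T. is_pole (Delta p T lam) z \<and> zorder (Delta p T lam) z = -1)))
     \<and> residue (Delta p T lam) (\<i> / 2) = - residue (Delta p T lam) (- \<i> / 2)
    \<comment> \<open>(iii)\<close>
     \<and> (\<not> (\<exists>c. \<forall>s. s \<notin> Lam T \<longrightarrow> Delta p T lam s = c) \<longrightarrow>
          {s. s \<notin> Lam T \<and> deriv (Delta p T lam) s = 0}
            = {c + z | c z. c \<in> {0, of_real (om T) / 2, of_real (om T) / 2 + \<i>, \<i>} \<and> z \<in> Mlat T}
        \<and> (\<forall>s. s \<notin> Lam T \<and> deriv (Delta p T lam) s = 0 \<longrightarrow>
               deriv (deriv (Delta p T lam)) s \<noteq> 0))"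
proof -
  interpret F: toeplitz_family T "qcoef p T" lam
    by unfold_locales (use T_pos lam_nz summable_qcoef[OF T_pos p_sum] in auto)
  let ?D = "Delta p T lam"
  let ?q = "qcoef p T"
  have Deq: "Delta p T l s = fredholm_det_I_minus (kern (om T) ?q l s)" if "l \<noteq> 0" "s \<notin> Lam T" for l s
    using Delta_eq_fredholm(2)[OF T_pos that p_sum] .
  have Dfd: "?D s = F.fd ?q s" if "s \<notin> Lam T" for s
    using Deq[OF lam_nz that] by (simp add: F.fd_def)
  have lim: "(\<lambda>N. DeltaN p T N lam s) \<longlonglongrightarrow> ?D s" if "s \<notin> Lam T" for s
    using Delta_eq_fredholm[OF T_pos lam_nz that p_sum] by simp
  have ulim: "uniform_limit {s. infdist s (Lam T) > \<delta>} (\<lambda>N s. DeltaN p T N lam s) ?D sequentially" if "\<delta> > 0" for \<delta>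
  proof -
    have nL: "s \<notin> Lam T" if "s \<in> {s. infdist s (Lam T) > \<delta>}" for s using that \<open>\<delta> > 0\<close> by auto
    have "DeltaN p T N lam s = F.fd (trunc N ?q) s" "?D s = F.fd ?q s"
      if "s \<in> {s. infdist s (Lam T) > \<delta>}" for N s
      using DeltaN_eq[OF nL[OF that]] Dfd[OF nL[OF that]] by (auto simp: F.fd_def)
    thus ?thesis using F.fd_uniform_limit[OF that] unfolding uniform_limit_iff by simp
  qed
  have fred: "?D s = fredholm_det_I_minus (\<lambda>n m. Hmat p T s n m / lam)" if "s \<notin> Lam T" for s
    using Deq[OF lam_nz that] fredholm_Hmat[OF that] by simp
  have even: "?D (- s) = ?D s" if "s \<notin> Lam T" for s
    using fredholm_kern_uminus[OF that] Deq[OF lam_nz] that by simp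
  have per: "?D (s + of_real (om T)) = ?D s" if "s \<notin> Lam T" for s
    using fredholm_kern_shift Deq[OF lam_nz] that by simp
  have conj: "cnj (?D s) = Delta p T (cnj lam) (cnj s)" if "s \<notin> Lam T" for s
    using cnj_fredholm_kern[where q = ?q, OF that cnj_qcoef] Deq[OF lam_nz that] Deq[of "cnj lam" "cnj s"] lam_nz that by simp
  \<comment> \<open>Stated for every nonzero \<open>l\<close>, since the period
    \<open>2 * \<i>\<close> needs it once for \<open>lam\<close> and once for
    \<open>- lam\<close>.\<close>
  have flip: "Delta p T l (s + \<i>) = Delta p T (- l) s" if "l \<noteq> 0" "s \<notin> Lam T" for l s
    using fredholm_kern_add_i Deq[of l "s + \<i>"] Deq[of "- l" s] that by simp
  have per2: "?D (s + 2 * \<i>) = ?D s" if "s \<notin> Lam T" for s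
  proof -
    have "s + 2 * \<i> = s + \<i> + \<i>" by simp
    hence "?D (s + 2 * \<i>) = ?D (s + \<i> + \<i>)" by (rule arg_cong)
    also have "\<dots> = Delta p T (- lam) (s + \<i>)" using flip[OF lam_nz, of "s + \<i>"] that by simp
    also have "\<dots> = ?D s" using flip[of "- lam" s] lam_nz that by simp
    finally show ?thesis .
  qed
  have holo: "?D holomorphic_on - Lam T"
    by (rule holomorphic_transform[OF F.fd_holomorphic]) (use Dfd in auto)
  obtain e0 B where e0: "e0 > 0" "\<And>s. s \<in> ball (\<i> / 2) e0 - {\<i> / 2} \<Longrightarrow> norm ((s - \<i> / 2) * F.fd ?q s) \<le> B"
    by (rule F.fd_near_pole) blast
  \<comment> \<open>Shrinking the disc keeps out all other points of \<open>Lam T\<close>, where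
    \<open>Delta\<close> has not been identified with \<open>fd\<close>.\<close>
  define e1 where "e1 = min e0 (min (om T) 1)"
  have e1: "e1 > 0" using e0(1) F.om_pos by (simp add: e1_def)
  have near: "norm ((s - \<i> / 2) * ?D s) \<le> B" if s: "s \<in> ball (\<i> / 2) e1 - {\<i> / 2}" for s
  proof -
    have "s \<in> ball (\<i> / 2) e0 - {\<i> / 2}"
      using s subset_ball[of e1 e0 "\<i> / 2"] by (auto simp: e1_def)
    moreover have "s \<notin> Lam T"
      using s Lam_isolated[OF T_pos i_half_in_Lam] subset_ball[of e1 "min (om T) 1" "\<i> / 2"] unfolding e1_def by auto
    ultimately show ?thesis using e0(2)[of s] Dfd[of s] by simp
  qed
  obtain c r g e where A: "antiperiodic_elliptic T (\<lambda>s. ?D s - c) g r e"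
    using even_elliptic_split[OF T_pos holo even per per2 e1 near] by blast
  interpret A: antiperiodic_elliptic T "\<lambda>s. ?D s - c" g r e by (rule A)
  have split: "?D s = c + (?D s - c)" for s by simp
  \<comment> \<open>The residue \<open>r\<close> decides between the alternatives:
    \<open>r = 0\<close> gives a constant, so a nonconstant \<open>Delta\<close> has
    \<open>r\<close> nonzero and the statements on poles and critical points apply.\<close>
  have const: "\<exists>c. \<forall>s. s \<notin> Lam T \<longrightarrow> ?D s = c" if "r = 0"
    using A.eq_0_if_no_pole[OF that] by (intro exI[of _ c]) simp
  have poles: "\<forall>z\<in>Lam T. is_pole ?D z \<and> zorder ?D z = -1" if "r \<noteq> 0"
    using A.simple_pole_at_Lam[OF that split] by blast
  have crit: "{s. s \<notin> Lam T \<and> deriv ?D s = 0}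
      = {c + z | c z. c \<in> {0, of_real (om T) / 2, of_real (om T) / 2 + \<i>, \<i>} \<and> z \<in> Mlat T}"
    "\<forall>s. s \<notin> Lam T \<and> deriv ?D s = 0 \<longrightarrow> deriv (deriv ?D) s \<noteq> 0" if "r \<noteq> 0"
    using A.critical_points_translate[OF that split] by blast+
  show ?thesis
  proof (intro conjI allI impI)
    show "(\<exists>c. \<forall>s. s \<notin> Lam T \<longrightarrow> ?D s = c) \<or> (?D holomorphic_on - Lam T
        \<and> (\<forall>z\<in>Lam T. is_pole ?D z \<and> zorder ?D z = -1))"
      using const holo poles by blast
    show "residue ?D (\<i> / 2) = - residue ?D (- \<i> / 2)"
      by (rule A.residues_opposite[OF split])
    show "{s. s \<notin> Lam T \<and> deriv ?D s = 0}
        = {c + z | c z. c \<in> {0, of_real (om T) / 2, of_real (om T) / 2 + \<i>, \<i>} \<and> z \<in> Mlat T}"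
      if "\<not> (\<exists>c. \<forall>s. s \<notin> Lam T \<longrightarrow> ?D s = c)"
      using crit(1) const that by blast
    show "deriv (deriv ?D) s \<noteq> 0"
      if "\<not> (\<exists>c. \<forall>s. s \<notin> Lam T \<longrightarrow> ?D s = c)" "s \<notin> Lam T \<and> deriv ?D s = 0" for s
      using crit(2) const that by blast
  qed ((elim conjE)?, rule lim ulim fred even per per2 conj flip[OF lam_nz], assumption)+
qed

end
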